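(* Let $n\geq 2$, $1<p<\infty$, and let $|\cdot|$ be the Euclidean norm on $\mathbb{R}^{n}$. Then for every $f\in C_{0}^{\infty}(\mathbb{R}^{n}\setminus\{0\})$, $$\sup_{R>0}\left\|\frac{f-f_{R}}{|x|^{\frac{n}{p}}\log\frac{R}{|x|}}\right\|_{L^{p}(\mathbb{R}^{n})}\leq \frac{p}{p-1}\left\|\frac{1}{|x|^{\frac{n}{p}-1}}\,\frac{x}{|x|}\cdot\nabla f\right\|_{L^{p}(\mathbb{R}^{n})}\leq \frac{p}{p-1}\left\|\frac{1}{|x|^{\frac{n}{p}-1}}\nabla f\right\|_{L^{p}(\mathbb{R}^{n})},$$ where $f_{R}(x)=f\left(R\frac{x}{|x|}\right)$. Moreover, the constant $\frac{p}{p-1}$ is sharp.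
   Context: $\nabla$ is the standard gradient in $\mathbb{R}^{n}$. $C_0^\infty(\mathbb{R}^n\setminus\{0\})$ denotes complex-valued smooth functions with compact support in $\mathbb{R}^n\setminus\{0\}$. "Sharp" means that the constant $\frac{p}{p-1}$ cannot be replaced by a smaller constant valid for all such $f$ in the inequality bounding the left-hand supremum by the (radial or full) gradient norm. *)

theory Defs
  imports "HOL-Analysis.Analysis"
begin

definition partial_deriv ::
  "'n \<Rightarrow> (real ^ 'n \<Rightarrow> complex) \<Rightarrow> real ^ 'n \<Rightarrow> complex" where
  "partial_deriv i f x = frechet_derivative f (at x) (axis i 1)"

definition grad :: "(real ^ 'n \<Rightarrow> complex) \<Rightarrow> real ^ 'n \<Rightarrow> complex ^ 'n" where
  "grad f x = (\<chi> i. partial_deriv i f x)"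

primrec C_k :: "nat \<Rightarrow> (real ^ 'n \<Rightarrow> complex) \<Rightarrow> bool" where
  "C_k 0 f \<longleftrightarrow> continuous_on UNIV f"
| "C_k (Suc k) f \<longleftrightarrow> f differentiable_on UNIV \<and> (\<forall>i. C_k k (partial_deriv i f))"

(* Functions on the punctured space are identified with their extension by zero;
   the topological support is a compact set avoiding the origin. *)
definition test_fun_punctured :: "(real ^ 'n \<Rightarrow> complex) \<Rightarrow> bool" where
  "test_fun_punctured f \<longleftrightarrow>
     (\<forall>k. C_k k f) \<and> compact (closure {x. f x \<noteq> 0}) \<and> 0 \<notin> closure {x. f x \<noteq> 0}"

(* Takes the value \<infinity> when the integral diverges, so inequalities between
   such norms include the finiteness claim. *)
definition Lp_norm :: "real \<Rightarrow> (real ^ 'n \<Rightarrow> 'b::real_normed_vector) \<Rightarrow> ennreal" where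
  "Lp_norm p g =
     (let I = (\<integral>\<^sup>+ x. ennreal (norm (g x) powr p) \<partial>lborel)
      in if I = \<infinity> then \<infinity> else ennreal (enn2real I powr (1 / p)))"

definition spherical_restr :: "real \<Rightarrow> (real ^ 'n \<Rightarrow> complex) \<Rightarrow> real ^ 'n \<Rightarrow> complex" where
  "spherical_restr R f x = f (R *\<^sub>R (x /\<^sub>R norm x))"

(* Division by zero yields 0 at the origin and on the sphere of radius R; these are
   Lebesgue null sets, so the norms below are unaffected. *)

definition log_quotient ::
  "real \<Rightarrow> real \<Rightarrow> (real ^ 'n \<Rightarrow> complex) \<Rightarrow> real ^ 'n \<Rightarrow> complex" where
  "log_quotient p R f x =
     (f x - spherical_restr R f x) /\<^sub>R
       (norm x powr (real CARD('n) / p) * ln (R / norm x))"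

definition hardy_lhs :: "real \<Rightarrow> (real ^ 'n \<Rightarrow> complex) \<Rightarrow> ennreal" where
  "hardy_lhs p f = (SUP R\<in>{0<..}. Lp_norm p (log_quotient p R f))"

definition radial_deriv :: "(real ^ 'n \<Rightarrow> complex) \<Rightarrow> real ^ 'n \<Rightarrow> complex" where
  "radial_deriv f x = (\<Sum>i\<in>UNIV. complex_of_real ((x /\<^sub>R norm x) $ i) * grad f x $ i)"

definition radial_norm :: "real \<Rightarrow> (real ^ 'n \<Rightarrow> complex) \<Rightarrow> ennreal" where
  "radial_norm p f =
     Lp_norm p (\<lambda>x. (1 / norm x powr (real CARD('n) / p - 1)) *\<^sub>R radial_deriv f x)"

definition gradient_norm :: "real \<Rightarrow> (real ^ 'n \<Rightarrow> complex) \<Rightarrow> ennreal" where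
  "gradient_norm p f =
     Lp_norm p (\<lambda>x. (1 / norm x powr (real CARD('n) / p - 1)) *\<^sub>R grad f x)"

end

(* In the coordinate t = ln |x| along a ray, the left-hand integrand becomes |g(t) - g(a)|^p / |t - a|^p
   and the radial one |g'(t)|^p, so the inequality is the one-dimensional Hardy inequality on each ray.
   That one follows from Hoelder's inequality with the weight s^((p-1)/p^2) and Tonelli's theorem.
   The passage from R^n to rays needs no surface measure: averaging over the dilations x -> e^t x
   replaces the sphere by the shell 1 <= |x| < e.
   For sharpness, radial functions with R = 1 reduce to the line again, where smooth truncations of
   |t|^((p-1)/p) on both half-lines give quotients tending to (p/(p-1))^p: both integrals diverge
   logarithmically, while the truncations only cost bounded terms. *)
theory Submission
  imports Defs
begin

text \<open>Put q = p/(p-1). On the half-line, Hoelder's inequality with a weight s^\<alpha>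
  followed by Tonelli bounds the p-th powers with the constant 1 / ((1 - \<alpha> q)^(p-1) \<alpha>
  p). This is least at \<alpha> = 1/(p q), where it equals q^p; the choice of the weight comes from
  there. The radius R and the direction of the ray enter only through the base point ln (R / |y|),
  and the line inequality is uniform in its base point, so the supremum over R costs nothing. The
  extremal of the line inequality is unbounded and not smooth at the base point, whereas a test
  function has to be smooth and to vanish near 0 and near infinity. The cut-off is therefore applied
  to the derivative: its antiderivative is constant far out, and subtracting that constant produces
  compact support without changing f - f_R. Two parameters are chosen in order. The margin K of the
  cut-offs brings the quotient of the leading coefficients close to q^p; then the cut-off point L is
  taken so large that the logarithms absorb all terms depending on K.\<close>

section \<open>Hardy's inequality on the line\<close>

text \<open>Convexity: the graph of the p-th power lies above its tangent at \<open>c\<close>.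
  Integrating this with a well-chosen \<open>c\<close> replaces an appeal to Hoelder's inequality
  for integrals.\<close>

lemma powr_tangent_le:
  fixes u c p :: real
  assumes "1 < p" "0 \<le> u" "0 < c"
  shows "p * c powr (p - 1) * u \<le> u powr p + (p - 1) * c powr p"
proof -
  define q where "q = p / (p - 1)"
  have q: "q > 1" "1 / p + 1 / q = 1" "(p - 1) * q = p" "p / q = p - 1"
    using assms by (auto simp: q_def field_simps)
  have "u * c powr (p - 1) \<le> u powr p / p + (c powr (p - 1)) powr q / q"
    using Youngs_inequality[of p q u "c powr (p - 1)"] q assms by simp
  also have "(c powr (p - 1)) powr q = c powr p"
    by (simp add: powr_powr q)
  finally have "p * (u * c powr (p - 1)) \<le> p * (u powr p / p + c powr p / q)"
    using assms by (intro mult_left_mono) auto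
  also have "\<dots> = u powr p + (p - 1) * c powr p"
    using assms q by (simp add: distrib_left q_def)
  finally show ?thesis by (simp add: mult_ac)
qed

text \<open>Hoelder's inequality against the weight \<open>s powr (1 / (p * q))\<close>, \<open>q = p / (p - 1)\<close>; this
  particular exponent makes the final constant sharp.\<close>

lemma average_powr_le_weighted_integral:
  fixes h :: "real \<Rightarrow> real" and p t :: real
  defines "e \<equiv> (p - 1) / p"
  assumes p: "1 < p" and t: "0 < t" and cont: "continuous_on {0..t} h"
    and nonneg: "\<And>s. s \<in> {0..t} \<Longrightarrow> 0 \<le> h s"
  shows "(integral {0..t} h / t) powr p
    \<le> (p / (p - 1)) powr (p - 1) * t powr (- 1 - e) * integral {0..t} (\<lambda>s. h s powr p * s powr e)"
proof -
  define I where "I = integral {0..t} h"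
  define J where "J = integral {0..t} (\<lambda>s. h s powr p * s powr e)"
  \<comment> \<open>The dual factor of Hoelder's inequality, namely the integral of s^(e - 1) =
    s^(-1/p) over {0..t}.\<close>
  define K where "K = p / (p - 1) * t powr e"
  have e: "e > 0" "1 - e = 1 / p" "e \<noteq> 0" "inverse e = p / (p - 1)"
    using p by (auto simp: e_def field_simps)
  have K: "K > 0" using p t by (simp add: K_def)
  have hI: "(h has_integral I) {0..t}"
    unfolding I_def using cont by (intro integrable_integral integrable_continuous_interval)
  have hJ: "((\<lambda>s. h s powr p * s powr e) has_integral J) {0..t}"
    unfolding J_def using cont nonneg p e
    by (intro integrable_integral integrable_continuous_interval continuous_intros
        continuous_on_powr') auto
  have hK: "((\<lambda>s. s powr (e - 1)) has_integral K) {0..t}"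
    using has_integral_powr_from_0[of "e - 1" t] e t by (simp add: K_def divide_inverse mult_ac)
  have I0: "I \<ge> 0" unfolding I_def using nonneg by (rule integral_nonneg[OF has_integral_integrable[OF hI]])
  have J0: "J \<ge> 0" unfolding J_def
    by (rule integral_nonneg[OF has_integral_integrable[OF hJ]]) auto
  have "I powr p \<le> J * K powr (p - 1)"
  proof (cases "I = 0")
    case True
    then show ?thesis using p J0 by simp
  next
    case False
    \<comment> \<open>Equality in the tangent inequality means h s = c * s^(e - 1); integrating this
      over {0..t} gives I = c * K, which dictates \<open>c\<close>.\<close>
    define c where "c = I / K"
    have c: "c > 0" using False I0 K by (simp add: c_def)
    have "p * c powr (p - 1) * h s \<le> h s powr p * s powr e + (p - 1) * c powr p * s powr (e - 1)"
      if s: "s \<in> {0..t} - {0}" for s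
    proof -
      have s0: "s > 0" using s by auto
      have "p * c powr (p - 1) * (h s * s powr (1 / p)) \<le>
          (h s * s powr (1 / p)) powr p + (p - 1) * c powr p"
        using powr_tangent_le[of p "h s * s powr (1 / p)" c] p c nonneg s by simp
      also have "(h s * s powr (1 / p)) powr p = h s powr p * s"
        using p s0 nonneg[of s] s by (simp add: powr_mult powr_powr)
      finally have "s powr (e - 1) * (p * c powr (p - 1) * (h s * s powr (1 / p))) \<le>
          s powr (e - 1) * (h s powr p * s + (p - 1) * c powr p)"
        by (intro mult_left_mono) auto
      then have "(s powr (e - 1) * s powr (1 / p)) * (p * c powr (p - 1) * h s) \<le>
          h s powr p * (s powr (e - 1) * s) + (p - 1) * c powr p * s powr (e - 1)"
        by (simp add: algebra_simps)
      moreover have "s powr (e - 1) * s powr (1 / p) = 1"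
        using s0 e(2) by (simp add: algebra_simps flip: powr_add)
      moreover have "s powr (e - 1) * s = s powr e"
        using s0 by (simp add: powr_diff)
      ultimately show ?thesis
        by simp
    qed
    \<comment> \<open>At s = 0 both powers of s on the right are 0 by convention while
      \<open>h 0\<close> may be positive, so \<open>h\<close> is altered at that single
      point.\<close>
    then have *: "p * c powr (p - 1) * (if s = 0 then 0 else h s)
        \<le> h s powr p * s powr e + (p - 1) * c powr p * s powr (e - 1)" if "s \<in> {0..t}" for s
      using that by auto
    have "((\<lambda>s. if s = 0 then 0 else h s) has_integral I) {0..t}"
      by (rule has_integral_spike[OF negligible_sing[of 0] _ hI]) auto
    from has_integral_le[OF has_integral_mult_right[OF this]
        has_integral_add[OF hJ has_integral_mult_right[OF hK]] *]
    have "p * c powr (p - 1) * I \<le> J + (p - 1) * c powr p * K"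
      by simp
    moreover have "(p - 1) * c powr p * K = (p - 1) * (c powr (p - 1) * I)"
    proof -
      have "I = c * K"
        using K by (simp add: c_def)
      moreover have "c powr p = c powr (p - 1) * c"
        using c by (simp add: powr_diff)
      ultimately show ?thesis by simp
    qed
    ultimately have "c powr (p - 1) * I \<le> J"
      by (simp add: algebra_simps)
    moreover have "I powr p = c powr (p - 1) * I * K powr (p - 1)"
      using K I0 False by (simp add: c_def powr_divide powr_diff)
    ultimately show ?thesis
      by (simp add: mult_right_mono)
  qed
  then have "(I / t) powr p \<le> J * (K powr (p - 1) / t powr p)"
    using t I0 by (simp add: powr_divide divide_right_mono)
  also have "K powr (p - 1) / t powr p = (p / (p - 1)) powr (p - 1) * t powr (- 1 - e)"
  proof -
    have "e * (p - 1) - p = - 1 - e"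
      using p by (simp add: e_def field_simps)
    moreover have "K powr (p - 1) = (p / (p - 1)) powr (p - 1) * t powr (e * (p - 1))"
      unfolding K_def by (simp only: powr_mult powr_powr)
    ultimately show ?thesis
      by (simp flip: powr_diff times_divide_eq_right)
  qed
  finally show ?thesis
    by (simp add: I_def J_def mult_ac)
qed

text \<open>After the weighted bound, Tonelli is applied on the region 0 < s \<le> t. The inner
  integral of t^(-1 - e) over t \<ge> s is q * s^(-e): the power cancels the weight s^e, and the
  factor q completes q^(p-1) to q^p.\<close>

lemma hardy_half_line:
  fixes h :: "real \<Rightarrow> real"
  assumes p: "1 < p" and cont: "continuous_on UNIV h" and nonneg: "\<And>s. 0 \<le> h s"
  shows "(\<integral>\<^sup>+ t. ennreal ((integral {0..t} h / t) powr p) * indicator {0<..} t \<partial>lborel)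
    \<le> ennreal ((p / (p - 1)) powr p) * (\<integral>\<^sup>+ s. ennreal (h s powr p) * indicator {0<..} s \<partial>lborel)"
proof -
  define e where "e = (p - 1) / p"
  define q where "q = p / (p - 1)"
  have e: "e > 0" and q: "q > 0" "q = 1 / e" and qp: "q powr (p - 1) * q = q powr p"
    using p by (auto simp: e_def q_def powr_diff)
  have [measurable]: "h \<in> borel_measurable borel"
    using cont by (rule borel_measurable_continuous_onI)
  have "(\<integral>\<^sup>+ t. ennreal ((integral {0..t} h / t) powr p) * indicator {0<..} t \<partial>lborel)
    \<le> (\<integral>\<^sup>+ t. (\<integral>\<^sup>+ s. ennreal (q powr (p - 1) * t powr (- 1 - e) * (h s powr p * s powr e)) *
          (indicator {0<..} s * indicator {s..} t) \<partial>lborel) \<partial>lborel)"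
  proof (intro nn_integral_mono)
    fix t :: real
    show "ennreal ((integral {0..t} h / t) powr p) * indicator {0<..} t \<le>
      (\<integral>\<^sup>+ s. ennreal (q powr (p - 1) * t powr (- 1 - e) * (h s powr p * s powr e)) *
          (indicator {0<..} s * indicator {s..} t) \<partial>lborel)"
    proof (cases "0 < t")
      case True
      have c: "continuous_on {0..t} h"
        using cont continuous_on_subset by blast
      have "((\<lambda>s. h s powr p * s powr e) has_integral
          integral {0..t} (\<lambda>s. h s powr p * s powr e)) {0..t}"
        using c nonneg p e by (intro integrable_integral integrable_continuous_interval
            continuous_intros continuous_on_powr') auto
      from has_integral_mult_right[OF this, of "q powr (p - 1) * t powr (- 1 - e)"]
      have "(\<integral>\<^sup>+ s. ennreal (q powr (p - 1) * t powr (- 1 - e) * (h s powr p * s powr e)) *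
            indicator {0..t} s \<partial>lborel) =
          ennreal (q powr (p - 1) * t powr (- 1 - e) * integral {0..t} (\<lambda>s. h s powr p * s powr e))"
        by (intro nn_integral_has_integral_lebesgue') auto
      moreover have "(\<lambda>s. ennreal (q powr (p - 1) * t powr (- 1 - e) * (h s powr p * s powr e)) *
            indicator {0..t} s) =
          (\<lambda>s. ennreal (q powr (p - 1) * t powr (- 1 - e) * (h s powr p * s powr e)) *
            (indicator {0<..} s * indicator {s..} t))"
        by (auto simp: fun_eq_iff indicator_def)
      moreover have "(integral {0..t} h / t) powr p \<le>
          q powr (p - 1) * t powr (- 1 - e) * integral {0..t} (\<lambda>s. h s powr p * s powr e)"
        unfolding q_def e_def
        by (rule average_powr_le_weighted_integral) (use p True c nonneg in auto)
      ultimately show ?thesis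
        using True by (simp add: ennreal_leI)
    qed simp
  qed
  also have "\<dots> = (\<integral>\<^sup>+ s. (\<integral>\<^sup>+ t. ennreal (q powr (p - 1) * t powr (- 1 - e) * (h s powr p * s powr e)) *
          (indicator {0<..} s * indicator {s..} t) \<partial>lborel) \<partial>lborel)"
  proof (intro lborel_pair.Fubini')
    \<comment> \<open>The set \<open>{s..}\<close> moves with s, so joint measurability is shown
      with the region written as a predicate on pairs.\<close>
    have "(\<lambda>(s, t). ennreal (q powr (p - 1) * t powr (- 1 - e) * (h s powr p * s powr e)) *
        (if 0 < s \<and> s \<le> t then 1 else 0)) \<in> borel_measurable (lborel \<Otimes>\<^sub>M lborel)"
      by measurable
    also have "(\<lambda>(s, t). ennreal (q powr (p - 1) * t powr (- 1 - e) * (h s powr p * s powr e)) *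
        (if 0 < s \<and> s \<le> t then 1 else 0)) =
      (\<lambda>(s, t). ennreal (q powr (p - 1) * t powr (- 1 - e) * (h s powr p * s powr e)) *
          (indicator {0<..} s * indicator {s..} t))"
      by (auto simp: fun_eq_iff indicator_def)
    finally show "(\<lambda>(s, t). ennreal (q powr (p - 1) * t powr (- 1 - e) * (h s powr p * s powr e)) *
          (indicator {0<..} s * indicator {s..} t)) \<in> borel_measurable (lborel \<Otimes>\<^sub>M lborel)" .
  qed
  also have "\<dots> = (\<integral>\<^sup>+ s. ennreal (q powr p) * (ennreal (h s powr p) * indicator {0<..} s) \<partial>lborel)"
  proof (intro nn_integral_cong)
    fix s :: real
    show "(\<integral>\<^sup>+ t. ennreal (q powr (p - 1) * t powr (- 1 - e) * (h s powr p * s powr e)) *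
          (indicator {0<..} s * indicator {s..} t) \<partial>lborel) =
      ennreal (q powr p) * (ennreal (h s powr p) * indicator {0<..} s)"
    proof (cases "0 < s")
      case True
      have "((\<lambda>t. t powr (- 1 - e)) has_integral (q * s powr (- e))) {s..}"
        using has_integral_powr_to_inf[of "- 1 - e" s] True e q by simp
      from has_integral_mult_right[OF this, of "q powr (p - 1) * (h s powr p * s powr e)"]
      have "(\<integral>\<^sup>+ t. ennreal (q powr (p - 1) * (h s powr p * s powr e) * t powr (- 1 - e)) *
            indicator {s..} t \<partial>lborel) =
          ennreal (q powr (p - 1) * (h s powr p * s powr e) * (q * s powr (- e)))"
        by (intro nn_integral_has_integral_lebesgue') auto
      also have "q powr (p - 1) * (h s powr p * s powr e) * (q * s powr (- e)) = q powr p * h s powr p"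
        using True by (simp add: powr_minus flip: qp)
      finally show ?thesis
        using True by (simp add: mult_ac ennreal_mult)
    qed simp
  qed
  also have "\<dots> = ennreal (q powr p) * (\<integral>\<^sup>+ s. ennreal (h s powr p) * indicator {0<..} s \<partial>lborel)"
    by (intro nn_integral_cmult) simp
  finally show ?thesis by (simp add: q_def)
qed

lemma hardy_half_line_vector:
  fixes g g' :: "real \<Rightarrow> 'a::euclidean_space"
  assumes p: "1 < p" and deriv: "\<And>t. (g has_vector_derivative g' t) (at t)"
    and cont: "continuous_on UNIV g'"
  shows "(\<integral>\<^sup>+ t. ennreal ((norm (g t - g 0) / \<bar>t\<bar>) powr p) * indicator {0<..} t \<partial>lborel)
    \<le> ennreal ((p / (p - 1)) powr p) * (\<integral>\<^sup>+ s. ennreal (norm (g' s) powr p) * indicator {0<..} s \<partial>lborel)"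
proof -
  define h where "h = (\<lambda>s. norm (g' s))"
  have "(\<integral>\<^sup>+ t. ennreal ((norm (g t - g 0) / \<bar>t\<bar>) powr p) * indicator {0<..} t \<partial>lborel)
    \<le> (\<integral>\<^sup>+ t. ennreal ((integral {0..t} h / t) powr p) * indicator {0<..} t \<partial>lborel)"
  proof (rule nn_integral_mono)
    fix t :: real
    show "ennreal ((norm (g t - g 0) / \<bar>t\<bar>) powr p) * indicator {0<..} t \<le>
        ennreal ((integral {0..t} h / t) powr p) * indicator {0<..} t"
    proof (cases "0 < t")
      case True
      have "(g' has_integral (g t - g 0)) {0..t}"
        using True by (intro fundamental_theorem_of_calculus has_vector_derivative_at_within[OF deriv]) simp
      moreover have "norm (integral {0..t} g') \<le> integral {0..t} h"
      proof (rule integral_norm_bound_integral)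
        have c: "continuous_on {0..t} g'"
          by (rule continuous_on_subset[OF cont]) simp
        show "g' integrable_on {0..t}" "h integrable_on {0..t}"
          unfolding h_def by (intro integrable_continuous_interval continuous_on_norm c)+
      qed (simp add: h_def)
      ultimately have "norm (g t - g 0) \<le> integral {0..t} h"
        by (simp add: integral_unique)
      then show ?thesis
        using True p by (auto intro!: ennreal_leI powr_mono2 divide_right_mono)
    qed simp
  qed
  also have "\<dots> \<le> ennreal ((p / (p - 1)) powr p) * (\<integral>\<^sup>+ s. ennreal (h s powr p) * indicator {0<..} s \<partial>lborel)"
    using p cont by (intro hardy_half_line) (simp_all add: h_def continuous_on_norm)
  finally show ?thesis by (simp add: h_def)
qed

text \<open>Folds the two sides of \<open>a\<close> onto the positive half-line, where the one-sided
  results live. The point \<open>a\<close> itself is a null set.\<close>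

lemma nn_integral_split_at:
  fixes F :: "real \<Rightarrow> ennreal"
  assumes [measurable]: "F \<in> borel_measurable borel"
  shows "(\<integral>\<^sup>+ t. F t \<partial>lborel) = (\<integral>\<^sup>+ t. F (a + t) * indicator {0<..} t \<partial>lborel) +
    (\<integral>\<^sup>+ t. F (a - t) * indicator {0<..} t \<partial>lborel)"
proof -
  have "(\<integral>\<^sup>+ t. F t \<partial>lborel) =
      (\<integral>\<^sup>+ t. F (a + t) * indicator {0<..} t + F (a + t) * indicator {..<0} t \<partial>lborel)"
    by (subst nn_integral_real_affine[of _ 1 a])
       (auto intro!: nn_integral_cong_AE eventually_mono[OF AE_lborel_singleton[of 0]]
             simp: indicator_def)
  also have "\<dots> = (\<integral>\<^sup>+ t. F (a + t) * indicator {0<..} t \<partial>lborel) +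
      (\<integral>\<^sup>+ t. F (a + t) * indicator {..<0} t \<partial>lborel)"
    by (intro nn_integral_add) auto
  also have "(\<integral>\<^sup>+ t. F (a + t) * indicator {..<0} t \<partial>lborel) =
      (\<integral>\<^sup>+ t. F (a - t) * indicator {0<..} t \<partial>lborel)"
    by (subst nn_integral_real_affine[of _ "-1" 0])
       (auto intro!: nn_integral_cong simp: indicator_def)
  finally show ?thesis .
qed

text \<open>The half-line inequality is applied to t \<mapsto> g (a + t) and t \<mapsto> g (a - t)
  and the results are added. The constant is the same on both sides and does not depend on
  \<open>a\<close>, as different rays and radii will need.\<close>

lemma hardy_line:
  fixes g g' :: "real \<Rightarrow> 'a::euclidean_space"
  assumes p: "1 < p" and deriv: "\<And>t. (g has_vector_derivative g' t) (at t)"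
    and cont: "continuous_on UNIV g'"
  shows "(\<integral>\<^sup>+ t. ennreal ((norm (g t - g a) / \<bar>t - a\<bar>) powr p) \<partial>lborel)
    \<le> ennreal ((p / (p - 1)) powr p) * (\<integral>\<^sup>+ t. ennreal (norm (g' t) powr p) \<partial>lborel)"
proof -
  have [measurable]: "g \<in> borel_measurable borel" "g' \<in> borel_measurable borel"
    using cont has_vector_derivative_continuous[OF deriv]
    by (auto intro!: borel_measurable_continuous_onI continuous_at_imp_continuous_on)
  have "((\<lambda>t. g (a + t)) has_vector_derivative g' (a + t)) (at t)" for t
  proof -
    have "((\<lambda>t. a + t) has_vector_derivative 1) (at t)"
      unfolding has_real_derivative_iff_has_vector_derivative[symmetric]
      by (auto intro!: derivative_eq_intros)
    from vector_diff_chain_at[OF this deriv] show ?thesis by (simp add: o_def)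
  qed
  then have *: "(\<integral>\<^sup>+ t. ennreal ((norm (g (a + t) - g (a + 0)) / \<bar>t\<bar>) powr p) * indicator {0<..} t \<partial>lborel)
    \<le> ennreal ((p / (p - 1)) powr p) * (\<integral>\<^sup>+ t. ennreal (norm (g' (a + t)) powr p) * indicator {0<..} t \<partial>lborel)"
    by (intro hardy_half_line_vector p)
       (auto intro!: continuous_on_minus continuous_on_compose2[OF cont] continuous_intros)
  have "((\<lambda>t. g (a - t)) has_vector_derivative - g' (a - t)) (at t)" for t
  proof -
    have "((\<lambda>t. a - t) has_vector_derivative - 1) (at t)"
      unfolding has_real_derivative_iff_has_vector_derivative[symmetric]
      by (auto intro!: derivative_eq_intros)
    from vector_diff_chain_at[OF this deriv] show ?thesis by (simp add: o_def)
  qed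
  then have "(\<integral>\<^sup>+ t. ennreal ((norm (g (a - t) - g (a - 0)) / \<bar>t\<bar>) powr p) * indicator {0<..} t \<partial>lborel)
    \<le> ennreal ((p / (p - 1)) powr p) * (\<integral>\<^sup>+ t. ennreal (norm (- g' (a - t)) powr p) * indicator {0<..} t \<partial>lborel)"
    by (intro hardy_half_line_vector p)
       (auto intro!: continuous_on_minus continuous_on_compose2[OF cont] continuous_intros)
  from add_mono[OF * this] show ?thesis
    by (subst (1 2) nn_integral_split_at[where a = a]) (simp_all add: distrib_left)
qed

section \<open>Integration along rays\<close>

lemma nn_integral_scaleR_lborel:
  fixes H :: "'a::euclidean_space \<Rightarrow> ennreal"
  assumes [measurable]: "H \<in> borel_measurable borel" and c: "0 < c"
  shows "(\<integral>\<^sup>+ x. H x \<partial>lborel) = ennreal (c ^ DIM('a)) * (\<integral>\<^sup>+ x. H (c *\<^sub>R x) \<partial>lborel)"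
  using c
  by (subst lborel_affine[of c 0])
     (simp_all add: nn_integral_density nn_integral_distr nn_integral_cmult)

text \<open>Polar coordinates without the sphere: the shell \<open>1 \<le> norm y < exp 1\<close> is a fundamental
  domain, on average, of the dilations \<open>x \<mapsto> exp t *\<^sub>R x\<close>, since
  \<open>\<integral> indicator {t. t \<le> ln (norm x) < t + 1} = 1\<close> for every \<open>x \<noteq> 0\<close>.\<close>

definition unit_shell :: "'a::real_normed_vector set" where
  "unit_shell = {y. 1 \<le> norm y \<and> norm y < exp 1}"

lemma unit_shell_sets [measurable]: "(unit_shell :: 'a::euclidean_space set) \<in> sets borel"
  unfolding unit_shell_def by measurable

lemma scaleR_exp_in_unit_shell_iff:
  assumes "x \<noteq> 0"
  shows "exp (- t) *\<^sub>R x \<in> unit_shell \<longleftrightarrow> t \<in> {ln (norm x) - 1<..ln (norm x)}"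
proof -
  have "1 \<le> exp (- t) * norm x \<longleftrightarrow> exp t \<le> norm x"
    "exp (- t) * norm x < exp 1 \<longleftrightarrow> norm x < exp (1 + t)"
    by (simp_all add: exp_minus exp_add field_simps)
  moreover have "exp t \<le> norm x \<longleftrightarrow> t \<le> ln (norm x)"
    "norm x < exp (1 + t) \<longleftrightarrow> ln (norm x) < 1 + t"
    using assms by (auto simp: ln_ge_iff not_le[symmetric])
  ultimately show ?thesis
    by (auto simp: unit_shell_def)
qed

text \<open>The factor 1, written as the integral over t of the indicator of the dilated shell, is
  inserted under the integral. Tonelli, the substitution x = exp t * y with its Jacobian, and
  Tonelli again give the formula.\<close>

lemma nn_integral_unit_shell:
  fixes H :: "'a::euclidean_space \<Rightarrow> ennreal"
  assumes [measurable]: "H \<in> borel_measurable borel"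
  shows "(\<integral>\<^sup>+ x. H x \<partial>lborel) =
    (\<integral>\<^sup>+ y. indicator unit_shell y *
       (\<integral>\<^sup>+ t. ennreal (exp t ^ DIM('a)) * H (exp t *\<^sub>R y) \<partial>lborel) \<partial>lborel)"
proof -
  have "(\<integral>\<^sup>+ t. indicator unit_shell (exp (- t) *\<^sub>R x) \<partial>lborel) = (1 :: ennreal)" if "x \<noteq> 0" for x :: 'a
  proof -
    have "(\<lambda>t. indicator unit_shell (exp (- t) *\<^sub>R x) :: ennreal) = indicator {ln (norm x) - 1<..ln (norm x)}"
      using that by (auto simp: scaleR_exp_in_unit_shell_iff indicator_def)
    then show ?thesis by simp
  qed
  then have "(\<integral>\<^sup>+ x. H x \<partial>lborel) =
      (\<integral>\<^sup>+ x. H x * (\<integral>\<^sup>+ t. indicator unit_shell (exp (- t) *\<^sub>R x) \<partial>lborel) \<partial>lborel)"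
    by (intro nn_integral_cong_AE eventually_mono[OF AE_lborel_singleton[of 0]]) auto
  also have "\<dots> = (\<integral>\<^sup>+ x. (\<integral>\<^sup>+ t. H x * indicator unit_shell (exp (- t) *\<^sub>R x) \<partial>lborel) \<partial>lborel)"
    by (subst nn_integral_cmult) auto
  also have "\<dots> = (\<integral>\<^sup>+ t. (\<integral>\<^sup>+ x. H x * indicator unit_shell (exp (- t) *\<^sub>R x) \<partial>lborel) \<partial>lborel)"
    by (intro lborel_pair.Fubini') measurable
  also have "\<dots> = (\<integral>\<^sup>+ t. (\<integral>\<^sup>+ y. indicator unit_shell y * (ennreal (exp t ^ DIM('a)) * H (exp t *\<^sub>R y)) \<partial>lborel) \<partial>lborel)"
  proof (rule nn_integral_cong)
    fix t :: real
    have "(\<integral>\<^sup>+ x. H x * indicator unit_shell (exp (- t) *\<^sub>R x) \<partial>lborel) =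
        ennreal (exp t ^ DIM('a)) * (\<integral>\<^sup>+ y. H (exp t *\<^sub>R y) * indicator unit_shell (exp (- t) *\<^sub>R exp t *\<^sub>R y) \<partial>lborel)"
      by (rule nn_integral_scaleR_lborel) auto
    also have "\<dots> = (\<integral>\<^sup>+ y. ennreal (exp t ^ DIM('a)) * (H (exp t *\<^sub>R y) *
        indicator unit_shell (exp (- t) *\<^sub>R exp t *\<^sub>R y)) \<partial>lborel)"
      by (intro nn_integral_cmult[symmetric]) simp
    finally show "(\<integral>\<^sup>+ x. H x * indicator unit_shell (exp (- t) *\<^sub>R x) \<partial>lborel) =
        (\<integral>\<^sup>+ y. indicator unit_shell y * (ennreal (exp t ^ DIM('a)) * H (exp t *\<^sub>R y)) \<partial>lborel)"
      by (simp add: mult_ac flip: exp_add)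
  qed
  also have "\<dots> = (\<integral>\<^sup>+ y. (\<integral>\<^sup>+ t. indicator unit_shell y * (ennreal (exp t ^ DIM('a)) * H (exp t *\<^sub>R y)) \<partial>lborel) \<partial>lborel)"
    by (intro lborel_pair.Fubini') measurable
  also have "\<dots> = (\<integral>\<^sup>+ y. indicator unit_shell y *
       (\<integral>\<^sup>+ t. ennreal (exp t ^ DIM('a)) * H (exp t *\<^sub>R y) \<partial>lborel) \<partial>lborel)"
    by (subst nn_integral_cmult) auto
  finally show ?thesis .
qed

section \<open>The inequality\<close>

lemma Lp_norm_le_mult:
  fixes g1 :: "real ^ 'n \<Rightarrow> 'b::real_normed_vector" and g2 :: "real ^ 'n \<Rightarrow> 'c::real_normed_vector"
  assumes "0 < p" "0 < K"
    and le: "(\<integral>\<^sup>+ x. ennreal (norm (g1 x) powr p) \<partial>lborel) \<le>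
      ennreal (K powr p) * (\<integral>\<^sup>+ x. ennreal (norm (g2 x) powr p) \<partial>lborel)"
  shows "Lp_norm p g1 \<le> ennreal K * Lp_norm p g2"
proof -
  define I1 I2 where "I1 = (\<integral>\<^sup>+ x. ennreal (norm (g1 x) powr p) \<partial>lborel)"
    and "I2 = (\<integral>\<^sup>+ x. ennreal (norm (g2 x) powr p) \<partial>lborel)"
  have le: "I1 \<le> ennreal (K powr p) * I2"
    using le by (simp add: I1_def I2_def)
  show ?thesis
  proof (cases "I2 = \<infinity>")
    case True
    then show ?thesis
      using assms by (simp add: Lp_norm_def I2_def ennreal_mult_eq_top_iff)
  next
    case False
    then obtain r2 where r2: "I2 = ennreal r2" "0 \<le> r2" by (cases I2) auto
    have *: "I1 \<le> ennreal (K powr p * r2)"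
      using le r2 by (simp add: ennreal_mult)
    then obtain r1 where r1: "I1 = ennreal r1" "0 \<le> r1" by (cases I1) (auto simp: top_unique)
    have "r1 \<le> K powr p * r2"
      using * r1 r2 by simp
    then have "r1 powr (1 / p) \<le> (K powr p * r2) powr (1 / p)"
      using assms r1 by (intro powr_mono2) auto
    also have "\<dots> = K * r2 powr (1 / p)"
      using assms r2 by (simp add: powr_mult powr_powr)
    finally show ?thesis
      using r1 r2 assms unfolding Lp_norm_def I1_def[symmetric] I2_def[symmetric]
      by (simp add: ennreal_leI flip: ennreal_mult)
  qed
qed

text \<open>The way back, for the sharpness argument: a supposed better norm inequality becomes one
  between integrals, which can be computed. Here \<open>K\<close> may be 0, since the constant to be
  refuted is arbitrary.\<close>

lemma Lp_norm_le_mult_imp_nn_integral_le: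
  fixes g1 :: "real ^ 'n \<Rightarrow> 'b::real_normed_vector" and g2 :: "real ^ 'n \<Rightarrow> 'c::real_normed_vector"
  assumes "0 < p" "0 \<le> K" "(\<integral>\<^sup>+ x. ennreal (norm (g2 x) powr p) \<partial>lborel) \<noteq> \<infinity>"
    and le: "Lp_norm p g1 \<le> ennreal K * Lp_norm p g2"
  shows "(\<integral>\<^sup>+ x. ennreal (norm (g1 x) powr p) \<partial>lborel) \<le>
      ennreal (K powr p) * (\<integral>\<^sup>+ x. ennreal (norm (g2 x) powr p) \<partial>lborel)"
proof -
  define I1 I2 where "I1 = (\<integral>\<^sup>+ x. ennreal (norm (g1 x) powr p) \<partial>lborel)"
    and "I2 = (\<integral>\<^sup>+ x. ennreal (norm (g2 x) powr p) \<partial>lborel)"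
  obtain r2 where r2: "I2 = ennreal r2" "0 \<le> r2" using assms(3) unfolding I2_def[symmetric] by (cases I2) auto
  have le: "(if I1 = \<infinity> then \<infinity> else ennreal (enn2real I1 powr (1 / p))) \<le> ennreal (K * r2 powr (1 / p))"
    using le assms r2 unfolding Lp_norm_def I1_def[symmetric] I2_def[symmetric]
    by (simp add: ennreal_mult)
  then obtain r1 where r1: "I1 = ennreal r1" "0 \<le> r1" by (cases I1) (auto simp: top_unique)
  have "r1 powr (1 / p) \<le> K * r2 powr (1 / p)"
    using le r1 assms by simp
  then have "(r1 powr (1 / p)) powr p \<le> (K * r2 powr (1 / p)) powr p"
    using assms by (intro powr_mono2) auto
  then have "r1 \<le> K powr p * r2"
    using assms r1 r2 by (simp add: powr_mult powr_powr)
  then show ?thesis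
    using r1 r2 unfolding I1_def[symmetric] I2_def[symmetric]
    by (simp add: ennreal_leI flip: ennreal_mult)
qed

section \<open>The radial derivative and the gradient\<close>

lemma test_fun_punctured_differentiable:
  assumes "test_fun_punctured f"
  shows "f differentiable at x" "continuous_on UNIV (partial_deriv i f)"
proof -
  have "C_k (Suc 0) f"
    using assms by (simp only: test_fun_punctured_def)
  then show "f differentiable at x" "continuous_on UNIV (partial_deriv i f)"
    by (auto simp: differentiable_on_def)
qed

lemma frechet_derivative_eq_sum_partial_deriv:
  assumes "f differentiable at x"
  shows "frechet_derivative f (at x) v = (\<Sum>i\<in>UNIV. (v $ i) *\<^sub>R partial_deriv i f x)"
proof -
  have lin: "linear (frechet_derivative f (at x))"
    by (rule linear_frechet_derivative[OF assms])
  have "frechet_derivative f (at x) v = frechet_derivative f (at x) (\<Sum>i\<in>UNIV. (v $ i) *\<^sub>R axis i 1)"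
    using basis_expansion[of v] by (simp add: scalar_mult_eq_scaleR)
  then show ?thesis
    by (simp add: linear_sum[OF lin] linear_scale[OF lin] partial_deriv_def)
qed

lemma radial_deriv_eq_frechet_derivative:
  assumes "f differentiable at x"
  shows "radial_deriv f x = frechet_derivative f (at x) (x /\<^sub>R norm x)"
  by (simp add: radial_deriv_def grad_def frechet_derivative_eq_sum_partial_deriv[OF assms]
      scaleR_conv_of_real)

text \<open>Cauchy-Schwarz between the complex gradient and the real direction vector, whose length
  is 1 away from the origin and, as division by zero gives 0, vanishes at the origin.\<close>

lemma norm_radial_deriv_le: "norm (radial_deriv f x) \<le> norm (grad f x)"
proof -
  have "norm (radial_deriv f x) \<le> (\<Sum>i\<in>UNIV. \<bar>(x /\<^sub>R norm x) $ i\<bar> * \<bar>norm (grad f x $ i)\<bar>)"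
    unfolding radial_deriv_def by (intro order_trans[OF norm_sum]) (simp add: norm_mult norm_inverse abs_mult)
  also have "\<dots> \<le> L2_set (\<lambda>i. (x /\<^sub>R norm x) $ i) UNIV * L2_set (\<lambda>i. norm (grad f x $ i)) UNIV"
    by (rule L2_set_mult_ineq)
  also have "L2_set (\<lambda>i. (x /\<^sub>R norm x) $ i) UNIV = norm (x /\<^sub>R norm x)"
    by (simp add: norm_vec_def L2_set_def)
  also have "L2_set (\<lambda>i. norm (grad f x $ i)) UNIV = norm (grad f x)"
    by (simp add: norm_vec_def)
  also have "norm (x /\<^sub>R norm x) * norm (grad f x) \<le> 1 * norm (grad f x)"
    by (intro mult_right_mono) (cases "x = 0", auto)
  finally show ?thesis by simp
qed

lemma borel_measurable_vec_nth_comp [measurable (raw)]: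
  fixes h :: "'a \<Rightarrow> 'b::real_normed_vector ^ 'n"
  assumes "h \<in> borel_measurable M"
  shows "(\<lambda>x. h x $ i) \<in> borel_measurable M"
  by (rule measurable_compose[OF assms borel_measurable_continuous_onI])
     (intro continuous_intros)

lemma radial_norm_le_gradient_norm: "1 < p \<Longrightarrow> radial_norm p f \<le> gradient_norm p f"
  unfolding radial_norm_def gradient_norm_def
  by (subst mult_1_left[symmetric], subst ennreal_1[symmetric], rule Lp_norm_le_mult)
     (auto intro!: nn_integral_mono ennreal_leI powr_mono2 mult_left_mono norm_radial_deriv_le divide_right_mono)

section \<open>Passing to the logarithmic coordinate on a ray\<close>

lemma scaleR_exp_div_norm: "(exp t *\<^sub>R y) /\<^sub>R norm (exp t *\<^sub>R y) = y /\<^sub>R norm y"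
  for y :: "'a::real_normed_vector"
  unfolding sgn_div_norm[symmetric] by (simp add: sgn_scaleR)

text \<open>In the coordinate \<open>t = ln (norm x)\<close> along a ray both integrands lose their weights.\<close>

lemma exp_pow_log_quotient:
  fixes y :: "real ^ 'n"
  assumes "1 < p" "0 < R" "y \<noteq> 0"
  shows "exp t ^ CARD('n) * norm (log_quotient p R f (exp t *\<^sub>R y)) powr p =
    norm y powr (- real CARD('n)) *
    (norm (f (exp t *\<^sub>R y) - f (exp (ln (R / norm y)) *\<^sub>R y)) / \<bar>t - ln (R / norm y)\<bar>) powr p"
proof -
  define n where "n = real CARD('n)"
  define d u where "d = norm (f (exp t *\<^sub>R y) - f (exp (ln (R / norm y)) *\<^sub>R y))"
    and "u = \<bar>t - ln (R / norm y)\<bar>"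
  define W where "W = norm (exp t *\<^sub>R y) powr (n / p)"
  have y: "norm y > 0" using assms by simp
  \<comment> \<open>The ray t \<mapsto> exp t * y meets the sphere of radius R at the time ln (R /
    norm y), whatever t is on the left.\<close>
  have sph: "spherical_restr R f (exp t *\<^sub>R y) = f (exp (ln (R / norm y)) *\<^sub>R y)"
  proof -
    have "spherical_restr R f (exp t *\<^sub>R y) = f (R *\<^sub>R (y /\<^sub>R norm y))"
      unfolding spherical_restr_def scaleR_exp_div_norm ..
    then show ?thesis
      using assms by (simp add: divide_inverse)
  qed
  have ln: "\<bar>ln (R / norm (exp t *\<^sub>R y))\<bar> = u"
    using assms by (simp add: u_def ln_div ln_mult)
  have W: "W powr p = exp t powr n * norm y powr n"
    using assms by (simp add: W_def powr_powr) (simp add: powr_mult)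
  have "norm (log_quotient p R f (exp t *\<^sub>R y)) = d / (W * u)"
    unfolding log_quotient_def sph n_def[symmetric] W_def[symmetric] ln[symmetric]
    by (simp add: d_def abs_mult W_def divide_inverse mult_ac)
  then have "exp t ^ CARD('n) * norm (log_quotient p R f (exp t *\<^sub>R y)) powr p =
      exp t powr n * (d powr p / (W powr p * u powr p))"
    by (simp add: powr_divide powr_mult n_def powr_realpow)
  also have "\<dots> = norm y powr (- n) * (d / u) powr p"
    unfolding W using y by (simp add: powr_minus powr_divide field_simps)
  finally show ?thesis
    by (simp add: d_def u_def n_def)
qed

text \<open>The weight contributes norm x to the power p - n: the part -n cancels the Jacobian up to
  a factor depending on \<open>y\<close> only, and the part p is the length factor in the derivative
  along t \<mapsto> exp t * y. \<open>F\<close> is generic because the inequality needs the radial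
  derivative and sharpness needs the gradient.\<close>

lemma exp_pow_radial_deriv:
  fixes y :: "real ^ 'n" and F :: "real ^ 'n \<Rightarrow> 'b::real_normed_vector"
  assumes "1 < p" "y \<noteq> 0"
  shows "exp t ^ CARD('n) * norm ((1 / norm (exp t *\<^sub>R y) powr (real CARD('n) / p - 1)) *\<^sub>R F (exp t *\<^sub>R y)) powr p =
    norm y powr (- real CARD('n)) * norm ((exp t * norm y) *\<^sub>R F (exp t *\<^sub>R y)) powr p"
proof -
  define n B d where "n = real CARD('n)" and "B = exp t * norm y" and "d = norm (F (exp t *\<^sub>R y))"
  define W where "W = B powr (n / p - 1)"
  have B: "B > 0" using assms by (simp add: B_def)
  have y: "norm y > 0" using assms by simp
  have W: "W powr p = exp t powr n * norm y powr n / B powr p"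
  proof -
    have "(n / p - 1) * p = n - p"
      using assms by (simp add: left_diff_distrib)
    then have "W powr p = B powr (n - p)"
      by (simp only: W_def powr_powr)
    also have "\<dots> = B powr n / B powr p"
      by (rule powr_diff)
    finally show ?thesis
      by (simp add: B_def powr_mult)
  qed
  have "exp t ^ CARD('n) * norm ((1 / norm (exp t *\<^sub>R y) powr (n / p - 1)) *\<^sub>R F (exp t *\<^sub>R y)) powr p =
      exp t powr n * (d powr p / W powr p)"
    by (simp add: d_def W_def B_def powr_divide n_def powr_realpow)
  also have "\<dots> = norm y powr (- n) * (B powr p * d powr p)"
    unfolding W using y B by (simp add: powr_minus field_simps)
  also have "B powr p * d powr p = norm ((exp t * norm y) *\<^sub>R F (exp t *\<^sub>R y)) powr p"
    using B by (simp add: d_def B_def powr_mult)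
  finally show ?thesis
    by (simp add: n_def)
qed

text \<open>On each ray through the shell the weights reduce to one common factor depending on
  \<open>y\<close>, so \<open>hardy_line\<close> with base point ln (R / norm y) applies; its
  uniform constant comes out of the integral over the shell.\<close>

lemma hardy_log_quotient:
  fixes f :: "real ^ 'n \<Rightarrow> complex"
  assumes p: "1 < p" and R: "0 < R" and f: "test_fun_punctured f"
  shows "(\<integral>\<^sup>+ x. ennreal (norm (log_quotient p R f x) powr p) \<partial>lborel) \<le>
    ennreal ((p / (p - 1)) powr p) *
    (\<integral>\<^sup>+ x. ennreal (norm ((1 / norm x powr (real CARD('n) / p - 1)) *\<^sub>R radial_deriv f x) powr p) \<partial>lborel)"
proof -
  define K where "K = (p / (p - 1)) powr p"
  define D where "D = (\<lambda>x. (1 / norm x powr (real CARD('n) / p - 1)) *\<^sub>R radial_deriv f x)"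
  have contf: "continuous_on UNIV f"
    using test_fun_punctured_differentiable(1)[OF f]
    by (intro continuous_at_imp_continuous_on ballI differentiable_imp_continuous_within)
  have [measurable]: "f \<in> borel_measurable borel" "partial_deriv i f \<in> borel_measurable borel" for i
    using contf test_fun_punctured_differentiable(2)[OF f] by (auto intro!: borel_measurable_continuous_onI)
  have [measurable]: "log_quotient p R f \<in> borel_measurable borel"
    unfolding log_quotient_def spherical_restr_def by measurable
  have [measurable]: "D \<in> borel_measurable borel"
    unfolding D_def radial_deriv_def grad_def vec_lambda_beta by measurable
  have line: "(\<integral>\<^sup>+ t. ennreal (exp t ^ DIM(real ^ 'n)) * ennreal (norm (log_quotient p R f (exp t *\<^sub>R y)) powr p) \<partial>lborel) \<le>
      ennreal K * (\<integral>\<^sup>+ t. ennreal (exp t ^ DIM(real ^ 'n)) * ennreal (norm (D (exp t *\<^sub>R y)) powr p) \<partial>lborel)"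
    if y: "y \<in> unit_shell" for y
  proof -
    define a where "a = ln (R / norm y)"
    define w where "w = norm y powr (- real CARD('n))"
    define g where "g = (\<lambda>t. f (exp t *\<^sub>R y))"
    define g' where "g' = (\<lambda>t. (exp t * norm y) *\<^sub>R radial_deriv f (exp t *\<^sub>R y))"
    have y0: "y \<noteq> 0" using y by (auto simp: unit_shell_def)
    \<comment> \<open>Chain rule: the velocity of t \<mapsto> exp t * y is the position itself,
      which is its length times the radial unit vector. In this form both the derivative claim and
      the continuity of \<open>g'\<close> can be read off.\<close>
    have g'_eq: "g' t = frechet_derivative f (at (exp t *\<^sub>R y)) (exp t *\<^sub>R y)" for t
    proof -
      let ?D = "frechet_derivative f (at (exp t *\<^sub>R y))"
      have "g' t = (exp t * norm y) *\<^sub>R ?D ((1 / norm y) *\<^sub>R y)"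
        unfolding g'_def radial_deriv_eq_frechet_derivative[OF test_fun_punctured_differentiable(1)[OF f]]
          scaleR_exp_div_norm by (simp add: divide_inverse)
      also have "\<dots> = ?D ((exp t * norm y) *\<^sub>R (1 / norm y) *\<^sub>R y)"
        using linear_frechet_derivative[OF test_fun_punctured_differentiable(1)[OF f]]
        by (simp only: linear_scale)
      finally show ?thesis using y0 by simp
    qed
    have "(g has_vector_derivative g' t) (at t)" for t
    proof -
      have "((\<lambda>t. exp t *\<^sub>R y) has_vector_derivative exp t *\<^sub>R y) (at t)"
        by (auto intro!: derivative_eq_intros)
      moreover have "(f has_derivative frechet_derivative f (at (exp t *\<^sub>R y))) (at (exp t *\<^sub>R y))"
        using test_fun_punctured_differentiable(1)[OF f] by (simp add: frechet_derivative_works)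
      ultimately show ?thesis
        unfolding g_def g'_eq
        using vector_derivative_diff_chain_within[of "\<lambda>t. exp t *\<^sub>R y" "exp t *\<^sub>R y" t UNIV f]
        by (auto simp: o_def intro: has_derivative_at_withinI)
    qed
    moreover have "continuous_on UNIV g'"
      unfolding g'_eq[abs_def] frechet_derivative_eq_sum_partial_deriv[OF test_fun_punctured_differentiable(1)[OF f]]
      by (intro continuous_intros continuous_on_compose2[OF test_fun_punctured_differentiable(2)[OF f]]) auto
    ultimately have *: "(\<integral>\<^sup>+ t. ennreal ((norm (g t - g a) / \<bar>t - a\<bar>) powr p) \<partial>lborel)
        \<le> ennreal K * (\<integral>\<^sup>+ t. ennreal (norm (g' t) powr p) \<partial>lborel)"
      unfolding K_def by (intro hardy_line p)
    have [measurable]: "g \<in> borel_measurable borel" "g' \<in> borel_measurable borel"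
      unfolding g_def g'_def radial_deriv_def grad_def vec_lambda_beta by measurable
    have "(\<integral>\<^sup>+ t. ennreal (exp t ^ DIM(real ^ 'n)) * ennreal (norm (log_quotient p R f (exp t *\<^sub>R y)) powr p) \<partial>lborel)
        = (\<integral>\<^sup>+ t. ennreal w * ennreal ((norm (g t - g a) / \<bar>t - a\<bar>) powr p) \<partial>lborel)"
      using exp_pow_log_quotient[OF p R y0, of _ f]
      by (simp add: w_def g_def a_def flip: ennreal_mult)
    also have "\<dots> = ennreal w * (\<integral>\<^sup>+ t. ennreal ((norm (g t - g a) / \<bar>t - a\<bar>) powr p) \<partial>lborel)"
      by (intro nn_integral_cmult) measurable
    also have "\<dots> \<le> ennreal w * (ennreal K * (\<integral>\<^sup>+ t. ennreal (norm (g' t) powr p) \<partial>lborel))"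
      by (intro mult_left_mono *) simp
    also have "\<dots> = ennreal K * (\<integral>\<^sup>+ t. ennreal w * ennreal (norm (g' t) powr p) \<partial>lborel)"
      by (subst nn_integral_cmult) (auto simp: mult_ac)
    also have "(\<integral>\<^sup>+ t. ennreal w * ennreal (norm (g' t) powr p) \<partial>lborel) =
        (\<integral>\<^sup>+ t. ennreal (exp t ^ DIM(real ^ 'n)) * ennreal (norm (D (exp t *\<^sub>R y)) powr p) \<partial>lborel)"
      using exp_pow_radial_deriv[OF p y0, of _ "radial_deriv f"]
      by (simp add: w_def g'_def D_def flip: ennreal_mult)
    finally show ?thesis .
  qed
  have "(\<integral>\<^sup>+ x. ennreal (norm (log_quotient p R f x) powr p) \<partial>lborel) =
      (\<integral>\<^sup>+ y. indicator unit_shell y *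
         (\<integral>\<^sup>+ t. ennreal (exp t ^ DIM(real ^ 'n)) * ennreal (norm (log_quotient p R f (exp t *\<^sub>R y)) powr p) \<partial>lborel) \<partial>lborel)"
    by (rule nn_integral_unit_shell) measurable
  also have "\<dots> \<le> (\<integral>\<^sup>+ y. ennreal K * (indicator unit_shell y *
         (\<integral>\<^sup>+ t. ennreal (exp t ^ DIM(real ^ 'n)) * ennreal (norm (D (exp t *\<^sub>R y)) powr p) \<partial>lborel)) \<partial>lborel)"
    using line by (intro nn_integral_mono) (simp add: indicator_def)
  also have "\<dots> = ennreal K * (\<integral>\<^sup>+ y. indicator unit_shell y *
         (\<integral>\<^sup>+ t. ennreal (exp t ^ DIM(real ^ 'n)) * ennreal (norm (D (exp t *\<^sub>R y)) powr p) \<partial>lborel) \<partial>lborel)"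
    by (rule nn_integral_cmult) measurable
  also have "(\<integral>\<^sup>+ y. indicator unit_shell y *
         (\<integral>\<^sup>+ t. ennreal (exp t ^ DIM(real ^ 'n)) * ennreal (norm (D (exp t *\<^sub>R y)) powr p) \<partial>lborel) \<partial>lborel) =
      (\<integral>\<^sup>+ x. ennreal (norm (D x) powr p) \<partial>lborel)"
    by (rule nn_integral_unit_shell[symmetric]) measurable
  finally show ?thesis by (simp add: K_def D_def)
qed

lemma hardy_lhs_le_radial_norm:
  fixes f :: "real ^ 'n \<Rightarrow> complex"
  assumes p: "1 < p" and f: "test_fun_punctured f"
  shows "hardy_lhs p f \<le> ennreal (p / (p - 1)) * radial_norm p f"
  unfolding hardy_lhs_def radial_norm_def
  using p by (intro SUP_least Lp_norm_le_mult hardy_log_quotient f) auto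

section \<open>Smooth functions of one variable\<close>

text \<open>Relative to a set, meant to be open, because \<open>ln\<close> and real powers are
  smooth on the positive axis only. Derivatives are two-sided at each point, so the notion is
  local.\<close>

primrec Ck_real :: "nat \<Rightarrow> real set \<Rightarrow> (real \<Rightarrow> real) \<Rightarrow> bool" where
  "Ck_real 0 U f \<longleftrightarrow> continuous_on U f"
| "Ck_real (Suc k) U f \<longleftrightarrow> (\<forall>x\<in>U. f differentiable at x) \<and> Ck_real k U (deriv f)"

lemma Ck_real_cong:
  assumes "open U" "Ck_real k U f" "\<And>x. x \<in> U \<Longrightarrow> f x = g x"
  shows "Ck_real k U g"
  using assms(2,3)
proof (induction k arbitrary: f g)
  case 0
  then show ?case by (simp cong: continuous_on_cong)
next
  case (Suc k)
  have "deriv f x = deriv g x" if "x \<in> U" for x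
    using Suc.prems(2) \<open>open U\<close> that
    by (intro deriv_cong_ev) (auto simp: eventually_nhds)
  moreover have "g differentiable at x" if x: "x \<in> U" for x
  proof -
    obtain D where "(f has_derivative D) (at x)"
      using Suc.prems(1) x by (auto simp: differentiable_def)
    then have "(g has_derivative D) (at x)"
      by (rule has_derivative_transform_within_open[OF _ \<open>open U\<close> x Suc.prems(2)])
    then show ?thesis by (auto simp: differentiable_def)
  qed
  ultimately show ?case
    using Suc.IH[of "deriv f" "deriv g"] Suc.prems by simp
qed

lemma Ck_real_SucI:
  assumes "open U" "\<And>x. x \<in> U \<Longrightarrow> (f has_real_derivative f' x) (at x)" "Ck_real k U f'"
  shows "Ck_real (Suc k) U f"
proof -
  have "Ck_real k U (deriv f)"
    by (rule Ck_real_cong[OF assms(1,3)]) (use assms(2) DERIV_imp_deriv in force)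
  then show ?thesis
    using assms(2) by (auto simp: real_differentiable_def)
qed

lemma Ck_real_SucD:
  assumes "Ck_real (Suc k) U f"
  shows "Ck_real k U f"
  using assms
proof (induction k arbitrary: f)
  case 0
  then show ?case
    by (auto intro!: continuous_at_imp_continuous_on differentiable_imp_continuous_within)
qed simp

lemma Ck_real_DERIV:
  assumes "Ck_real (Suc k) U f" "x \<in> U"
  shows "(f has_real_derivative deriv f x) (at x)"
  using assms by (auto simp: DERIV_deriv_iff_real_differentiable)

text \<open>Serves to glue a formula valid on the positive axis to the zero function on an
  overlapping half-line.\<close>

lemma Ck_real_Un:
  assumes "open U" "open V"
  shows "Ck_real k U f \<Longrightarrow> Ck_real k V f \<Longrightarrow> Ck_real k (U \<union> V) f"
  using assms by (induction k arbitrary: f) (auto intro: continuous_on_open_Un)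

lemma Ck_real_const: "open U \<Longrightarrow> Ck_real k U (\<lambda>_. c)"
  by (induction k arbitrary: c) (auto simp del: Ck_real.simps(2) intro!: Ck_real_SucI derivative_eq_intros)

lemma Ck_real_ident: "open U \<Longrightarrow> Ck_real k U (\<lambda>x. x)"
  by (cases k) (auto simp del: Ck_real.simps(2) intro!: Ck_real_SucI Ck_real_const derivative_eq_intros)

lemma Ck_real_add:
  assumes "open U"
  shows "Ck_real k U f \<Longrightarrow> Ck_real k U g \<Longrightarrow> Ck_real k U (\<lambda>x. f x + g x)"
proof (induction k arbitrary: f g)
  case (Suc k)
  have "Ck_real k U (\<lambda>x. deriv f x + deriv g x)"
    using Suc by simp
  then show ?case
    by (rule Ck_real_SucI[OF assms, rotated]) (intro DERIV_add Ck_real_DERIV[OF Suc.prems(1)] Ck_real_DERIV[OF Suc.prems(2)])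
qed (simp add: continuous_on_add)

lemma Ck_real_mult:
  assumes "open U"
  shows "Ck_real k U f \<Longrightarrow> Ck_real k U g \<Longrightarrow> Ck_real k U (\<lambda>x. f x * g x)"
proof (induction k arbitrary: f g)
  case (Suc k)
  have "Ck_real k U (\<lambda>x. deriv f x * g x + deriv g x * f x)"
    using Suc.IH Suc.prems Ck_real_SucD[OF Suc.prems(1)] Ck_real_SucD[OF Suc.prems(2)]
    by (intro Ck_real_add assms) simp_all
  then show ?case
    by (rule Ck_real_SucI[OF assms, rotated]) (intro DERIV_mult Ck_real_DERIV[OF Suc.prems(1)] Ck_real_DERIV[OF Suc.prems(2)])
qed (simp add: continuous_on_mult)

lemma Ck_real_compose:
  assumes "open U" "f ` U \<subseteq> V"
  shows "Ck_real k V g \<Longrightarrow> Ck_real k U f \<Longrightarrow> Ck_real k U (\<lambda>x. g (f x))"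
proof (induction k arbitrary: g)
  case 0
  then show ?case
    using assms by (auto intro: continuous_on_compose2)
next
  case (Suc k)
  have "Ck_real k U (\<lambda>x. deriv g (f x) * deriv f x)"
    using Suc.IH Suc.prems Ck_real_SucD[OF Suc.prems(2)]
    by (intro Ck_real_mult assms) simp_all
  moreover have "((\<lambda>x. g (f x)) has_real_derivative deriv g (f x) * deriv f x) (at x)" if "x \<in> U" for x
    using assms(2) that
    by (intro DERIV_chain2[OF Ck_real_DERIV[OF Suc.prems(1)] Ck_real_DERIV[OF Suc.prems(2)]]) auto
  ultimately show ?case
    by (intro Ck_real_SucI[OF assms(1)])
qed

lemma Ck_real_powr: "Ck_real k {0<..} (\<lambda>x. x powr a)"
proof (induction k arbitrary: a)
  case (Suc k)
  have "Ck_real k {0<..} (\<lambda>x. a * x powr (a - 1))"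
    by (intro Ck_real_mult Ck_real_const Suc) auto
  then show ?case
    by (rule Ck_real_SucI[rotated 2]) (auto intro!: derivative_eq_intros)
qed (auto intro!: continuous_intros)

lemma Ck_real_ln: "Ck_real k {0<..} ln"
proof (cases k)
  case (Suc k')
  show ?thesis
    unfolding Suc
    by (rule Ck_real_SucI[OF _ _ Ck_real_powr[of _ "-1"]])
       (auto intro!: derivative_eq_intros simp: powr_minus divide_inverse)
qed (auto intro!: continuous_intros)

text \<open>The powers of \<open>inverse x\<close> are included so that the family is closed under differentiation, up to
  linear combinations.\<close>

definition flat_exp :: "nat \<Rightarrow> real \<Rightarrow> real" where
  "flat_exp n x = (if 0 < x then inverse x ^ n * exp (- inverse x) else 0)"

text \<open>From the right, u = inverse x tends to infinity and u^n / exp u tends to 0; from the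
  left the function is 0.\<close>

lemma tendsto_flat_exp_0: "(flat_exp n \<longlongrightarrow> 0) (at 0)"
proof -
  have "(flat_exp n \<longlongrightarrow> 0) (at_right 0)"
  proof -
    have "((\<lambda>x::real. inverse x ^ n / exp (inverse x)) \<longlongrightarrow> 0) (at_right 0)"
      by (rule filterlim_compose[OF tendsto_power_div_exp_0 filterlim_inverse_at_top_right])
    then show ?thesis
      by (rule tendsto_cong[THEN iffD1, rotated])
         (auto simp: flat_exp_def eventually_at_filter exp_minus divide_inverse)
  qed
  moreover have "(flat_exp n \<longlongrightarrow> 0) (at_left 0)"
    by (rule tendsto_eventually) (auto simp: flat_exp_def eventually_at_filter)
  ultimately show ?thesis
    by (simp add: filterlim_at_split)
qed

lemma flat_exp_has_derivative:
  "(flat_exp n has_real_derivative flat_exp (n + 2) x - real n * flat_exp (n + 1) x) (at x)"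
proof -
  consider "x > 0" | "x < 0" | "x = 0" by linarith
  then show ?thesis
  proof cases
    case 1
    have "((\<lambda>x. inverse x ^ n * exp (- inverse x)) has_real_derivative
        flat_exp (n + 2) x - real n * flat_exp (n + 1) x) (at x)"
    proof -
      have "real n * (inverse x ^ (n - Suc 0) * - (inverse x)\<^sup>2) = - real n * inverse x ^ (n + 1)"
        by (cases n) (simp_all add: power2_eq_square algebra_simps)
      moreover have "((\<lambda>x. inverse x ^ n) has_real_derivative real n * (inverse x ^ (n - Suc 0) * - (inverse x)\<^sup>2)) (at x)"
        using 1 by (auto intro!: derivative_eq_intros simp: power2_eq_square)
      ultimately have "((\<lambda>x. inverse x ^ n) has_real_derivative - real n * inverse x ^ (n + 1)) (at x)"
        by (simp only:)
      moreover have "((\<lambda>x. exp (- inverse x)) has_real_derivative exp (- inverse x) * (inverse x)\<^sup>2) (at x)"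
        using 1 by (auto intro!: derivative_eq_intros simp: power2_eq_square)
      ultimately show ?thesis
        by (rule DERIV_cong[OF DERIV_mult]) (use 1 in \<open>simp add: flat_exp_def power_add power2_eq_square algebra_simps\<close>)
    qed
    then show ?thesis
      by (rule has_field_derivative_transform_within_open[of _ _ _ "{0<..}"]) (use 1 in \<open>auto simp: flat_exp_def\<close>)
  next
    case 2
    have "((\<lambda>x. 0) has_real_derivative flat_exp (n + 2) x - real n * flat_exp (n + 1) x) (at x)"
      using 2 by (simp add: flat_exp_def)
    then show ?thesis
      by (rule has_field_derivative_transform_within_open[of _ _ _ "{..<0}"]) (use 2 in \<open>auto simp: flat_exp_def\<close>)
  next
    case 3
    \<comment> \<open>For y different from 0 the difference quotient at 0 is exactly
      \<open>flat_exp (n + 1) y\<close>, so the limit just proved gives the derivative 0.\<close>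
    have "((\<lambda>y. (flat_exp n y - flat_exp n 0) / (y - 0)) \<longlongrightarrow> 0) (at 0)"
      by (rule tendsto_cong[THEN iffD1, OF _ tendsto_flat_exp_0[of "n + 1"]])
         (auto simp: flat_exp_def eventually_at_filter divide_inverse)
    then show ?thesis
      using 3 by (simp add: has_field_derivative_iff flat_exp_def)
  qed
qed

lemma Ck_real_flat_exp: "Ck_real k UNIV (flat_exp n)"
proof (induction k arbitrary: n)
  case 0
  then show ?case
    using DERIV_isCont[OF flat_exp_has_derivative] by (simp add: continuous_at_imp_continuous_on)
next
  case (Suc k)
  have "Ck_real k UNIV (\<lambda>x. flat_exp (n + 2) x + (- real n) * flat_exp (n + 1) x)"
    by (intro Ck_real_add Ck_real_mult Ck_real_const Suc) auto
  then show ?case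
    by (rule Ck_real_SucI[rotated 2]) (use flat_exp_has_derivative in \<open>auto\<close>)
qed

lemma flat_exp_nonneg: "0 \<le> flat_exp n x"
  by (simp add: flat_exp_def)

lemma flat_exp_0_le_1: "flat_exp 0 x \<le> 1"
  by (simp add: flat_exp_def)

text \<open>As a cut-off \<open>flat_exp 0\<close> never reaches 1, but at distance \<open>K\<close>
  from its zero set the loss is at most the factor exp (-1/K), which tends to 1 as K grows. This
  takes the place of a bump function with a plateau.\<close>

lemma flat_exp_0_ge:
  assumes "0 < K" "K \<le> x"
  shows "exp (- 1 / K) \<le> flat_exp 0 x"
  using assms by (simp add: flat_exp_def divide_inverse le_imp_inverse_le)

section \<open>Radial test functions\<close>

text \<open>A formula for the total derivative yields differentiability and identifies all partial
  derivatives at once, so the higher orders can be treated on explicit candidates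
  \<open>g i\<close>.\<close>

lemma C_k_SucI:
  fixes f :: "real ^ 'n \<Rightarrow> complex"
  assumes "\<And>x. (f has_derivative (\<lambda>v. \<Sum>i\<in>UNIV. (v $ i) *\<^sub>R g i x)) (at x)" "\<And>i. C_k k (g i)"
  shows "C_k (Suc k) f" "partial_deriv i f = g i"
proof -
  have pd: "partial_deriv i f = g i" for i
  proof
    fix x
    have "partial_deriv i f x = (\<Sum>j\<in>UNIV. (axis i 1 :: real ^ 'n) $ j *\<^sub>R g j x)"
      unfolding partial_deriv_def by (subst frechet_derivative_at[OF assms(1), symmetric]) simp
    also have "\<dots> = (\<Sum>j\<in>UNIV. if j = i then g j x else 0)"
      by (intro sum.cong) (auto simp: axis_def)
    finally show "partial_deriv i f x = g i x" by simp
  qed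
  show "C_k (Suc k) f" "partial_deriv i f = g i"
    using assms by (auto simp: pd differentiable_on_def differentiable_def)
qed

lemma C_k_SucD: "C_k (Suc k) f \<Longrightarrow> C_k k f"
proof (induction k arbitrary: f)
  case 0
  then show ?case
    by (auto intro: differentiable_imp_continuous_on)
qed simp

lemma C_k_has_derivative:
  fixes f :: "real ^ 'n \<Rightarrow> complex"
  assumes "C_k (Suc k) f"
  shows "(f has_derivative (\<lambda>v. \<Sum>i\<in>UNIV. (v $ i) *\<^sub>R partial_deriv i f x)) (at x)"
proof -
  have d: "f differentiable at x"
    using assms by (simp add: differentiable_on_def)
  have "frechet_derivative f (at x) = (\<lambda>v. \<Sum>i\<in>UNIV. (v $ i) *\<^sub>R partial_deriv i f x)"
    using frechet_derivative_eq_sum_partial_deriv[OF d] by auto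
  then show ?thesis
    using d by (simp add: frechet_derivative_works)
qed

lemma C_k_add:
  fixes f g :: "real ^ 'n \<Rightarrow> complex"
  shows "C_k k f \<Longrightarrow> C_k k g \<Longrightarrow> C_k k (\<lambda>x. f x + g x)"
proof (induction k arbitrary: f g)
  case (Suc k)
  show ?case
    by (rule C_k_SucI(1)[where g = "\<lambda>i x. partial_deriv i f x + partial_deriv i g x"])
       (use Suc has_derivative_add[OF C_k_has_derivative[OF Suc.prems(1)] C_k_has_derivative[OF Suc.prems(2)]]
        in \<open>simp_all add: scaleR_add_right sum.distrib\<close>)
qed (simp add: continuous_on_add)

lemma C_k_mult:
  fixes f g :: "real ^ 'n \<Rightarrow> complex"
  shows "C_k k f \<Longrightarrow> C_k k g \<Longrightarrow> C_k k (\<lambda>x. f x * g x)"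
proof (induction k arbitrary: f g)
  case (Suc k)
  show ?case
  proof (rule C_k_SucI(1)[where g = "\<lambda>i x. f x * partial_deriv i g x + partial_deriv i f x * g x"])
    show "C_k k (\<lambda>x. f x * partial_deriv i g x + partial_deriv i f x * g x)" for i
      using Suc.IH Suc.prems C_k_SucD[OF Suc.prems(1)] C_k_SucD[OF Suc.prems(2)]
      by (intro C_k_add) simp_all
    show "((\<lambda>x. f x * g x) has_derivative
        (\<lambda>v. \<Sum>i\<in>UNIV. (v $ i) *\<^sub>R (f x * partial_deriv i g x + partial_deriv i f x * g x))) (at x)" for x
      using has_derivative_mult[OF C_k_has_derivative[OF Suc.prems(1)] C_k_has_derivative[OF Suc.prems(2)]]
      by (simp add: scaleR_add_right sum.distrib sum_distrib_left sum_distrib_right)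
  qed
qed (simp add: continuous_on_mult)

lemma C_k_const: "C_k k (\<lambda>_ :: real ^ 'n. c)"
proof (induction k arbitrary: c)
  case (Suc k)
  show ?case
    by (rule C_k_SucI(1)[where g = "\<lambda>i x. 0"]) (use Suc in auto)
qed simp

lemma C_k_component: "C_k k (\<lambda>x :: real ^ 'n. complex_of_real (x $ j))"
proof (cases k)
  case (Suc k')
  show ?thesis
    unfolding Suc
  proof (rule C_k_SucI(1)[where g = "\<lambda>i x. if i = j then 1 else 0"])
    show "C_k k' (\<lambda>x :: real ^ 'n. if i = j then 1 else 0)" for i
      by (rule C_k_const)
    have "(\<lambda>v. \<Sum>i\<in>UNIV. (v $ i) *\<^sub>R (if i = j then 1 else 0)) = (\<lambda>v :: real ^ 'n. complex_of_real (v $ j))"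
      by (simp add: scaleR_conv_of_real if_distrib cong: if_cong)
    then show "((\<lambda>x :: real ^ 'n. complex_of_real (x $ j)) has_derivative
        (\<lambda>v. \<Sum>i\<in>UNIV. (v $ i) *\<^sub>R (if i = j then 1 else 0))) (at x)" for x
      by (simp only:) (intro bounded_linear_imp_has_derivative
          bounded_linear_compose[OF bounded_linear_of_real bounded_linear_vec_nth])
  qed
qed (auto intro!: continuous_intros)

lemma has_derivative_radial:
  fixes x :: "real ^ 'n"
  assumes "(\<psi> has_real_derivative d) (at (x \<bullet> x))"
  shows "((\<lambda>x. complex_of_real (\<psi> (x \<bullet> x))) has_derivative
    (\<lambda>v. \<Sum>i\<in>UNIV. (v $ i) *\<^sub>R (complex_of_real d * complex_of_real (2 * x $ i)))) (at x)"
proof -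
  have "((\<lambda>x. x \<bullet> x) has_derivative (\<lambda>v. 2 * (x \<bullet> v))) (at x)"
    by (auto intro!: derivative_eq_intros simp: inner_commute)
  moreover have "(\<psi> has_derivative (\<lambda>s. d * s)) (at (x \<bullet> x))"
    using assms by (simp add: has_field_derivative_def)
  ultimately have "((\<lambda>x. \<psi> (x \<bullet> x)) has_derivative (\<lambda>v. d * (2 * (x \<bullet> v)))) (at x)"
    by (rule has_derivative_compose)
  then have "((\<lambda>x. complex_of_real (\<psi> (x \<bullet> x))) has_derivative (\<lambda>v. complex_of_real (d * (2 * (x \<bullet> v))))) (at x)"
    by (rule has_derivative_of_real)
  moreover have "(\<lambda>v. complex_of_real (d * (2 * (x \<bullet> v)))) =
    (\<lambda>v. \<Sum>i\<in>UNIV. (v $ i) *\<^sub>R (complex_of_real d * complex_of_real (2 * x $ i)))"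
    by (auto simp: fun_eq_iff inner_vec_def sum_distrib_left scaleR_conv_of_real mult_ac)
  ultimately show ?thesis by simp
qed

text \<open>With \<open>x \<bullet> x\<close> in place of the norm the inner function is a
  polynomial, smooth at the origin too. Each partial derivative is again radial up to a coordinate
  factor, so the induction closes under products.\<close>

lemma C_k_radial:
  "Ck_real k UNIV \<psi> \<Longrightarrow> C_k k (\<lambda>x :: real ^ 'n. complex_of_real (\<psi> (x \<bullet> x)))"
proof (induction k arbitrary: \<psi>)
  case 0
  then show ?case
    by (auto intro!: continuous_intros continuous_on_compose2[of UNIV \<psi>])
next
  case (Suc k)
  show ?case
  proof (rule C_k_SucI(1)[where g = "\<lambda>i x. complex_of_real (deriv \<psi> (x \<bullet> x)) * complex_of_real (2 * x $ i)"])
    show "C_k k (\<lambda>x. complex_of_real (deriv \<psi> (x \<bullet> x)) * complex_of_real (2 * x $ i))" for i :: 'n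
      unfolding of_real_mult using Suc by (intro C_k_mult C_k_const C_k_component) auto
  qed (rule has_derivative_radial[OF Ck_real_DERIV[OF Suc.prems UNIV_I]])
qed

lemma norm_grad_radial:
  fixes x :: "real ^ 'n"
  assumes "(\<psi> has_real_derivative d) (at (x \<bullet> x))"
  shows "norm (grad (\<lambda>x. complex_of_real (\<psi> (x \<bullet> x))) x) = 2 * \<bar>d\<bar> * norm x"
proof -
  let ?f = "\<lambda>x :: real ^ 'n. complex_of_real (\<psi> (x \<bullet> x))"
  have "partial_deriv i ?f x = complex_of_real (2 * d * x $ i)" for i
  proof -
    have "partial_deriv i ?f x = (\<Sum>j\<in>UNIV. (axis i 1 :: real ^ 'n) $ j *\<^sub>R (complex_of_real d * complex_of_real (2 * x $ j)))"
      unfolding partial_deriv_def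
      by (subst frechet_derivative_at[OF has_derivative_radial[OF assms], symmetric]) simp
    also have "\<dots> = (\<Sum>j\<in>UNIV. if j = i then complex_of_real (2 * d * x $ j) else 0)"
      by (intro sum.cong) (auto simp: axis_def)
    finally show ?thesis by simp
  qed
  then have "norm (grad ?f x) = L2_set (\<lambda>i. (2 * \<bar>d\<bar>) * \<bar>x $ i\<bar>) UNIV"
    by (simp add: norm_vec_def grad_def norm_mult abs_mult)
  also have "\<dots> = 2 * \<bar>d\<bar> * L2_set (\<lambda>i. \<bar>x $ i\<bar>) UNIV"
    by (rule L2_set_right_distrib[symmetric]) simp
  also have "L2_set (\<lambda>i. \<bar>x $ i\<bar>) UNIV = norm x"
    by (simp add: norm_vec_def L2_set_def)
  finally show ?thesis .
qed

text \<open>Squaring the logarithm makes the profile even under the inversion \<open>norm x \<mapsto> 1 / norm x\<close>, so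
  that a single \<open>\<Phi>\<close> handles both sides of the unit sphere.\<close>

definition log_profile :: "(real \<Rightarrow> real) \<Rightarrow> real \<Rightarrow> real" where
  "log_profile \<Phi> s = (if 0 < s then \<Phi> ((ln s)\<^sup>2) else 0)"

text \<open>Below exp (- sqrt L) the squared logarithm exceeds \<open>L\<close>, so the profile is
  zero there and joins the zero extension to s \<le> 0 smoothly.\<close>

lemma Ck_real_log_profile:
  assumes \<Phi>: "Ck_real k UNIV \<Phi>" and zero: "\<And>y. L \<le> y \<Longrightarrow> \<Phi> y = 0" and L: "0 < L"
  shows "Ck_real k UNIV (log_profile \<Phi>)"
proof -
  have "Ck_real k {0<..} (\<lambda>s. (ln s)\<^sup>2)"
    unfolding power2_eq_square by (intro Ck_real_mult Ck_real_ln) simp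
  then have "Ck_real k {0<..} (\<lambda>s. \<Phi> ((ln s)\<^sup>2))"
    by (intro Ck_real_compose[OF _ _ \<Phi>]) auto
  then have pos: "Ck_real k {0<..} (log_profile \<Phi>)"
    by (rule Ck_real_cong[rotated]) (auto simp: log_profile_def)
  have "log_profile \<Phi> s = 0" if "s < exp (- sqrt L)" for s
  proof (cases "0 < s")
    case True
    then have "ln s < - sqrt L"
      using that ln_less_cancel_iff[of s "exp (- sqrt L)"] by simp
    then have "(sqrt L)\<^sup>2 \<le> (ln s)\<^sup>2"
      using L by (intro abs_le_square_iff[THEN iffD1]) auto
    then show ?thesis
      using L zero by (simp add: log_profile_def)
  qed (simp add: log_profile_def)
  then have neg: "Ck_real k {..<exp (- sqrt L)} (log_profile \<Phi>)"
    by (intro Ck_real_cong[OF _ Ck_real_const[of _ _ 0]]) auto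
  have "{0<..} \<union> {..<exp (- sqrt L)} = (UNIV :: real set)"
    by (auto simp: not_less) (meson exp_gt_zero less_le_trans not_less)
  with Ck_real_Un[OF _ _ pos neg] show ?thesis by simp
qed

text \<open>A nonzero value forces |ln (x \<bullet> x)| < sqrt L. This one bound keeps the support
  away from infinity and from the origin.\<close>

lemma test_fun_punctured_log_profile:
  assumes \<Phi>: "\<And>k. Ck_real k UNIV \<Phi>" and zero: "\<And>y. L \<le> y \<Longrightarrow> \<Phi> y = 0" and L: "0 < L"
  shows "test_fun_punctured (\<lambda>x :: real ^ 'n. complex_of_real (log_profile \<Phi> (x \<bullet> x)))"
proof -
  let ?f = "\<lambda>x :: real ^ 'n. complex_of_real (log_profile \<Phi> (x \<bullet> x))"
  define S where "S = {x :: real ^ 'n. exp (- sqrt L) \<le> x \<bullet> x \<and> x \<bullet> x \<le> exp (sqrt L)}"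
  have "x \<in> S" if "?f x \<noteq> 0" for x
  proof -
    from that have s: "0 < x \<bullet> x" and "\<Phi> ((ln (x \<bullet> x))\<^sup>2) \<noteq> 0"
      by (auto simp: log_profile_def split: if_splits)
    then have "(ln (x \<bullet> x))\<^sup>2 < (sqrt L)\<^sup>2"
      using zero L by (force simp: not_le[symmetric])
    then have "\<bar>ln (x \<bullet> x)\<bar> < sqrt L"
      using L by (intro power2_less_imp_less[of "\<bar>ln (x \<bullet> x)\<bar>"]) simp_all
    then have "exp (- sqrt L) \<le> exp (ln (x \<bullet> x))" "exp (ln (x \<bullet> x)) \<le> exp (sqrt L)"
      unfolding exp_le_cancel_iff by linarith+
    then show ?thesis
      using s unfolding S_def by (simp only: exp_ln mem_Collect_eq simp_thms)
  qed
  then have sub: "{x. ?f x \<noteq> 0} \<subseteq> S" by blast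
  have cl: "closed S"
    unfolding S_def by (intro closed_Collect_conj closed_Collect_le continuous_intros)
  have bd: "bounded S"
    unfolding bounded_iff
  proof (intro exI ballI)
    fix x assume "x \<in> S"
    then have "(norm x)\<^sup>2 \<le> exp (sqrt L)"
      by (simp add: S_def power2_norm_eq_inner)
    then show "norm x \<le> sqrt (exp (sqrt L))"
      by (simp add: real_le_rsqrt)
  qed
  have csub: "closure {x. ?f x \<noteq> 0} \<subseteq> S"
    using sub cl by (rule closure_minimal)
  moreover have "0 \<notin> S"
    by (simp add: S_def)
  moreover have "compact (closure {x. ?f x \<noteq> 0})"
    using bd sub bounded_subset compact_closure by blast
  ultimately show ?thesis
    using C_k_radial[OF Ck_real_log_profile[OF \<Phi> zero L]] unfolding test_fun_punctured_def by blast
qed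

section \<open>Sharpness\<close>

text \<open>With \<open>a = 1 - (p - 1) / (2 * p)\<close> the antiderivative, taken at \<open>t\<^sup>2\<close>, grows like
  \<open>t powr ((p - 1) / p)\<close>, the extremal of Hardy's inequality that just fails to be admissible.\<close>

definition cut_powr :: "real \<Rightarrow> real \<Rightarrow> real \<Rightarrow> real" where
  "cut_powr a L y = y powr (- a) * (flat_exp 0 (y - 1) * flat_exp 0 (L - y))"

lemma cut_powr_nonneg: "0 \<le> cut_powr a L y"
  by (simp add: cut_powr_def flat_exp_nonneg)

lemma cut_powr_eq_0: "y \<le> 1 \<or> L \<le> y \<Longrightarrow> cut_powr a L y = 0"
  by (auto simp: cut_powr_def flat_exp_def)

lemma cut_powr_le: "cut_powr a L y \<le> y powr (- a)"
proof -
  have "flat_exp 0 (y - 1) * flat_exp 0 (L - y) \<le> 1 * 1"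
    by (intro mult_mono flat_exp_0_le_1 flat_exp_nonneg) simp
  then show ?thesis
    using mult_left_mono[of _ 1 "y powr (- a)"] by (simp add: cut_powr_def)
qed

lemma cut_powr_ge:
  assumes "0 < K" "1 + K \<le> y" "y \<le> L - K"
  shows "exp (- 2 / K) * y powr (- a) \<le> cut_powr a L y"
proof -
  have "exp (- 1 / K) * exp (- 1 / K) \<le> flat_exp 0 (y - 1) * flat_exp 0 (L - y)"
    using assms by (intro mult_mono flat_exp_0_ge flat_exp_nonneg) auto
  moreover have "exp (- 1 / K) * exp (- 1 / K) = exp (- 2 / K)"
    by (simp flip: exp_add)
  ultimately show ?thesis
    using mult_left_mono[of "exp (- 2 / K)" "flat_exp 0 (y - 1) * flat_exp 0 (L - y)" "y powr (- a)"]
    by (simp add: cut_powr_def mult.commute)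
qed

text \<open>The power is singular at 0, but the first cut-off already vanishes for y \<le> 1, so the
  half-lines y > 0 and y < 1 overlap and cover the line.\<close>

lemma Ck_real_cut_powr: "Ck_real k UNIV (cut_powr a L)"
proof -
  have "Ck_real k {0<..} (\<lambda>y. y + (- 1))"
    by (intro Ck_real_add Ck_real_ident Ck_real_const) auto
  moreover have "Ck_real k {0<..} (\<lambda>y. L + (- 1) * y)"
    by (intro Ck_real_add Ck_real_mult Ck_real_ident Ck_real_const) auto
  ultimately have "Ck_real k {0<..} (\<lambda>y. y powr (- a) * (flat_exp 0 (y + (- 1)) * flat_exp 0 (L + (- 1) * y)))"
    by (intro Ck_real_mult Ck_real_powr Ck_real_compose[OF _ _ Ck_real_flat_exp]) auto
  then have "Ck_real k {0<..} (cut_powr a L)"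
    by (rule Ck_real_cong[rotated]) (auto simp: cut_powr_def)
  moreover have "Ck_real k {..<1} (cut_powr a L)"
    by (rule Ck_real_cong[OF _ Ck_real_const[of _ _ 0]]) (auto simp: cut_powr_eq_0)
  ultimately have "Ck_real k ({0<..} \<union> {..<1}) (cut_powr a L)"
    by (intro Ck_real_Un) auto
  moreover have "{0<..} \<union> {..<1} = (UNIV :: real set)"
    by auto
  ultimately show ?thesis by simp
qed

lemma continuous_on_cut_powr: "continuous_on UNIV (cut_powr a L)"
  using Ck_real_cut_powr[of 0] by simp

lemma cut_powr_antiderivative:
  obtains F where "\<And>x. (F has_real_derivative cut_powr a L x) (at x)"
proof -
  have "isCont (cut_powr a L) x" for x
    using continuous_on_cut_powr by (simp add: continuous_on_eq_continuous_at)
  then have "\<exists>F. \<forall>x. -\<infinity> < ereal x \<longrightarrow> ereal x < \<infinity> \<longrightarrow> (F has_vector_derivative cut_powr a L x) (at x)"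
    by (intro einterval_antiderivative) auto
  then show ?thesis
    using that by (auto simp: has_real_derivative_iff_has_vector_derivative)
qed

text \<open>On [1 + K, L - K] the derivative of F is at least exp (-2/K) times that of x^b / b.
  Integration from 1 + K loses the initial value (1 + K)^b, and y \<ge> K (1 + K) makes this at most
  K^(-b) * y^b, a small fraction of the main term.\<close>

lemma cut_powr_antiderivative_ge:
  assumes F: "\<And>x. (F has_real_derivative cut_powr (1 - b) L x) (at x)"
    and b: "0 < b" and K: "1 \<le> K" and y: "K * (1 + K) \<le> y" "y \<le> L - K"
  shows "exp (- 2 / K) * (1 - K powr (- b)) / b * y powr b \<le> F y - F 0"
proof -
  define E where "E = exp (- 2 / K)"
  have E: "0 < E" by (simp add: E_def)
  have y1: "1 + K \<le> y"
    using order_trans[OF mult_right_mono[OF K, of "1 + K"] y(1)] K by simp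
  have mono: "F 0 \<le> F (1 + K)"
    by (rule DERIV_nonneg_imp_nondecreasing) (use K in simp, use F cut_powr_nonneg in blast)
  have "F (1 + K) - E * ((1 + K) powr b / b) \<le> F y - E * (y powr b / b)"
  proof (rule DERIV_nonneg_imp_nondecreasing[OF y1])
    fix x assume x: "1 + K \<le> x" "x \<le> y"
    have "((\<lambda>x. F x - E * (x powr b / b)) has_real_derivative cut_powr (1 - b) L x - E * x powr (- (1 - b))) (at x)"
      using x K b F by (auto intro!: derivative_eq_intros)
    moreover have "E * x powr (- (1 - b)) \<le> cut_powr (1 - b) L x"
      unfolding E_def using x K y by (intro cut_powr_ge) auto
    ultimately show "\<exists>d. ((\<lambda>x. F x - E * (x powr b / b)) has_real_derivative d) (at x) \<and> 0 \<le> d"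
      by fastforce
  qed
  moreover have "(1 + K) powr b \<le> K powr (- b) * y powr b"
  proof -
    have "(1 + K) powr b \<le> (y / K) powr b"
      using K y b by (intro powr_mono2) (auto simp: field_simps)
    then show ?thesis
      using K by (simp add: powr_divide powr_minus_divide)
  qed
  then have "E * ((1 + K) powr b / b) \<le> E * (K powr (- b) * y powr b / b)"
    using E b by (intro mult_left_mono divide_right_mono) auto
  moreover have "E * (1 - K powr (- b)) / b * y powr b = E * (y powr b / b) - E * (K powr (- b) * y powr b / b)"
    using b by (simp add: field_simps)
  ultimately show ?thesis
    using mono by (simp add: E_def)
qed

section \<open>Logarithmic divergence at the critical exponent\<close>

lemma nn_integral_inverse_interval:
  fixes c \<alpha> \<beta> :: real
  assumes "0 < \<alpha>" "\<alpha> \<le> \<beta>" "0 \<le> c"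
  shows "(\<integral>\<^sup>+ x. ennreal (c / x) * indicator {\<alpha>..\<beta>} x \<partial>lborel) = ennreal (c * (ln \<beta> - ln \<alpha>))"
proof (rule nn_integral_has_integral_lebesgue')
  have "((\<lambda>x. 1 / x) has_integral (ln \<beta> - ln \<alpha>)) {\<alpha>..\<beta>}"
  proof (rule fundamental_theorem_of_calculus)
    fix x assume "x \<in> {\<alpha>..\<beta>}"
    then have "(ln has_real_derivative 1 / x) (at x)"
      using assms by (auto intro!: derivative_eq_intros)
    then show "(ln has_vector_derivative 1 / x) (at x within {\<alpha>..\<beta>})"
      unfolding has_real_derivative_iff_has_vector_derivative
      by (rule has_vector_derivative_at_within)
  qed (use assms in simp)
  from has_integral_mult_right[OF this, of c]
  show "((\<lambda>x. c / x) has_integral c * (ln \<beta> - ln \<alpha>)) {\<alpha>..\<beta>}"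
    by simp
qed (use assms in auto)

text \<open>The exponent \<open>a\<close> is critical: (1 - 2 a) p = -1, so the integrand is at most
  2^p / t, supported in [1, sqrt L]. Its integral is the logarithm on the right.\<close>

lemma cut_powr_half_line_upper:
  assumes p: "1 < p" and L: "1 < L"
  shows "(\<integral>\<^sup>+ t. ennreal ((2 * \<bar>t\<bar> * cut_powr (1 - (p - 1) / (2 * p)) L (t\<^sup>2)) powr p) * indicator {0<..} t \<partial>lborel)
    \<le> ennreal (2 powr p * (ln L / 2))"
proof -
  define a where "a = 1 - (p - 1) / (2 * p)"
  have a: "(1 - 2 * a) * p = - 1"
    using p by (simp add: a_def field_simps)
  have "ennreal ((2 * \<bar>t\<bar> * cut_powr a L (t\<^sup>2)) powr p) * indicator {0<..} t \<le>
      ennreal (2 powr p / t) * indicator {1..sqrt L} t" for t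
  proof (cases "0 < t \<and> 1 < t\<^sup>2 \<and> t\<^sup>2 < L")
    case True
    then have t: "t \<in> {1..sqrt L}"
      using one_less_power power2_le_imp_le[of 1 t] by (auto intro!: real_le_rsqrt)
    have "2 * \<bar>t\<bar> * cut_powr a L (t\<^sup>2) \<le> 2 * \<bar>t\<bar> * (t\<^sup>2) powr (- a)"
      by (intro mult_left_mono cut_powr_le) simp
    also have "(t\<^sup>2) powr (- a) = t powr (- 2 * a)"
      using True powr_powr[of t 2 "- a"] by simp
    also have "2 * \<bar>t\<bar> * t powr (- 2 * a) = 2 * t powr (1 - 2 * a)"
      using True by (simp add: powr_diff powr_minus divide_inverse)
    finally have "(2 * \<bar>t\<bar> * cut_powr a L (t\<^sup>2)) powr p \<le> (2 * t powr (1 - 2 * a)) powr p"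
      using p by (intro powr_mono2) (auto simp: cut_powr_nonneg)
    also have "\<dots> = 2 powr p * (t powr (1 - 2 * a)) powr p"
      by (simp only: powr_mult)
    also have "\<dots> = 2 powr p / t"
      using True by (simp only: powr_powr a) (simp add: powr_minus divide_inverse)
    finally show ?thesis
      using t True by (simp add: ennreal_leI)
  next
    case False
    then have "indicator {0<..} t = (0 :: ennreal) \<or> cut_powr a L (t\<^sup>2) = 0"
      by (auto simp: indicator_def intro: cut_powr_eq_0)
    then show ?thesis by auto
  qed
  then have "(\<integral>\<^sup>+ t. ennreal ((2 * \<bar>t\<bar> * cut_powr a L (t\<^sup>2)) powr p) * indicator {0<..} t \<partial>lborel) \<le>
      (\<integral>\<^sup>+ t. ennreal (2 powr p / t) * indicator {1..sqrt L} t \<partial>lborel)"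
    by (intro nn_integral_mono)
  also have "\<dots> = ennreal (2 powr p * (ln (sqrt L) - ln 1))"
    using L by (intro nn_integral_inverse_interval) auto
  also have "ln (sqrt L) - ln 1 = ln L / 2"
    using L by (simp add: ln_sqrt)
  finally show ?thesis by (simp add: a_def)
qed

text \<open>The same critical exponent appears, (2 b - 1) p = -1 with b = 1 - a. The coefficient 1/b
  = 2 p / (p - 1) carries the 2 that also occurs in the upper bound, so the quotient of the two
  leading coefficients is (p / (p - 1))^p up to the \<open>K\<close>-dependent loss.\<close>

lemma cut_powr_half_line_lower:
  assumes p: "1 < p" and K: "1 \<le> K" and L: "K * (1 + K) \<le> L - K"
    and F: "\<And>x. (F has_real_derivative cut_powr (1 - (p - 1) / (2 * p)) L x) (at x)"
  shows "ennreal ((exp (- 2 / K) * (1 - K powr (- ((p - 1) / (2 * p)))) * (2 * (p / (p - 1)))) powr p *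
      ((ln (L - K) - ln (K * (1 + K))) / 2))
    \<le> (\<integral>\<^sup>+ t. ennreal ((\<bar>F (t\<^sup>2) - F 0\<bar> / \<bar>t\<bar>) powr p) * indicator {0<..} t \<partial>lborel)"
proof -
  define b where "b = (p - 1) / (2 * p)"
  define c where "c = exp (- 2 / K) * (1 - K powr (- b)) / b"
  have b: "b > 0" "(2 * b - 1) * p = - 1" "1 / b = 2 * (p / (p - 1))"
    using p by (auto simp: b_def field_simps)
  have c: "c \<ge> 0"
    using K b by (simp add: c_def powr_le_one_le powr_minus_divide ge_one_powr_ge_zero)
  have KK: "0 < K * (1 + K)"
    using K by simp
  have "ennreal (c powr p * ((ln (L - K) - ln (K * (1 + K))) / 2)) =
      ennreal (c powr p * (ln (sqrt (L - K)) - ln (sqrt (K * (1 + K)))))"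
    using KK L by (simp add: ln_sqrt diff_divide_distrib)
  also have "\<dots> = (\<integral>\<^sup>+ t. ennreal (c powr p / t) * indicator {sqrt (K * (1 + K))..sqrt (L - K)} t \<partial>lborel)"
    using KK L by (intro nn_integral_inverse_interval[symmetric]) auto
  also have "\<dots> \<le> (\<integral>\<^sup>+ t. ennreal ((\<bar>F (t\<^sup>2) - F 0\<bar> / \<bar>t\<bar>) powr p) * indicator {0<..} t \<partial>lborel)"
  proof (rule nn_integral_mono)
    fix t :: real
    show "ennreal (c powr p / t) * indicator {sqrt (K * (1 + K))..sqrt (L - K)} t \<le>
        ennreal ((\<bar>F (t\<^sup>2) - F 0\<bar> / \<bar>t\<bar>) powr p) * indicator {0<..} t"
    proof (cases "t \<in> {sqrt (K * (1 + K))..sqrt (L - K)}")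
      case True
      have t0: "0 < t"
        using True KK by (auto intro: less_le_trans[of 0 "sqrt (K * (1 + K))"])
      have t: "K * (1 + K) \<le> t\<^sup>2" "t\<^sup>2 \<le> L - K"
        using True KK t0 L by (auto intro: sqrt_le_D real_le_lsqrt simp: sqrt_le_D)
          (metis order_trans less_imp_le power_mono real_sqrt_pow2)
      have "c * t powr (2 * b) \<le> \<bar>F (t\<^sup>2) - F 0\<bar>"
        using cut_powr_antiderivative_ge[OF F[folded b_def] b(1) K t] t0
        by (simp add: c_def powr_powr flip: powr_numeral)
      then have "c * t powr (2 * b) / t \<le> \<bar>F (t\<^sup>2) - F 0\<bar> / \<bar>t\<bar>"
        using t0 by (simp add: divide_right_mono)
      also have "c * t powr (2 * b) / t = c * t powr (2 * b - 1)"
        using t0 by (simp add: powr_diff)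
      finally have "(c * t powr (2 * b - 1)) powr p \<le> (\<bar>F (t\<^sup>2) - F 0\<bar> / \<bar>t\<bar>) powr p"
        using p c by (intro powr_mono2) auto
      moreover have "(c * t powr (2 * b - 1)) powr p = c powr p / t"
        using t0 by (simp only: powr_mult powr_powr b) (simp add: powr_minus divide_inverse)
      ultimately show ?thesis
        using True t0 by (simp add: ennreal_leI)
    qed simp
  qed
  also have "c = exp (- 2 / K) * (1 - K powr (- b)) * (2 * (p / (p - 1)))"
    unfolding b(3)[symmetric] by (simp add: c_def)
  finally show ?thesis by (simp add: b_def)
qed

text \<open>Comparison of leading coefficients as ln L tends to infinity: for L \<ge> 2 K the shift
  by \<open>K\<close> costs at most ln 2, and \<open>d\<close> is a constant.\<close>

lemma le_if_log_growth_le: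
  fixes A B :: real
  assumes "0 \<le> A" "0 < K" and le: "\<And>L. N \<le> L \<Longrightarrow> A * (ln (L - K) - d) \<le> B * ln L"
  shows "A \<le> B"
proof (rule ccontr)
  assume "\<not> A \<le> B"
  \<comment> \<open>Chosen so that (A - B) * M exceeds A * (ln 2 + d), by exactly A - B.\<close>
  define M where "M = A * (ln 2 + d) / (A - B) + 1"
  define L where "L = max (exp M) (max N (2 * K))"
  have L: "L > 0" "N \<le> L" "L / 2 \<le> L - K" "exp M \<le> L"
    by (auto simp: L_def less_max_iff_disj)
  have M: "M \<le> ln L"
    using L(1,4) by (simp add: ln_ge_iff)
  have "ln L - ln 2 \<le> ln (L - K)"
    using L by (subst ln_divide_pos[symmetric]) auto
  then have "A * (ln L - ln 2 - d) \<le> B * ln L"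
    using le[OF L(2)] \<open>0 \<le> A\<close> mult_left_mono[of "ln L - ln 2 - d" "ln (L - K) - d" A] by linarith
  then have "(A - B) * ln L \<le> A * (ln 2 + d)"
    by (simp add: algebra_simps)
  moreover have "(A - B) * M \<le> (A - B) * ln L"
    using M \<open>\<not> A \<le> B\<close> by (intro mult_left_mono) auto
  moreover have "(A - B) * M = A * (ln 2 + d) + (A - B)"
    using \<open>\<not> A \<le> B\<close> by (simp add: M_def field_simps)
  ultimately show False
    using \<open>\<not> A \<le> B\<close> by linarith
qed

text \<open>The function t \<mapsto> F (t^2) plays the role of the extremal, and the second
  integrand is the p-th power of the modulus of its derivative. Both integrands are even, so each
  integral is twice its half-line part.\<close>

lemma hardy_line_sharp:
  assumes p: "1 < p" and C: "0 \<le> C" "C < p / (p - 1)"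
  obtains L F where "1 < L" "\<And>x. (F has_real_derivative cut_powr (1 - (p - 1) / (2 * p)) L x) (at x)"
    "(\<integral>\<^sup>+ t. ennreal ((\<bar>F (t\<^sup>2) - F 0\<bar> / \<bar>t\<bar>) powr p) \<partial>lborel) >
     ennreal (C powr p) * (\<integral>\<^sup>+ t. ennreal ((2 * \<bar>t\<bar> * cut_powr (1 - (p - 1) / (2 * p)) L (t\<^sup>2)) powr p) \<partial>lborel)"
    "(\<integral>\<^sup>+ t. ennreal ((2 * \<bar>t\<bar> * cut_powr (1 - (p - 1) / (2 * p)) L (t\<^sup>2)) powr p) \<partial>lborel) < \<infinity>"
proof -
  define q b where "q = p / (p - 1)" and "b = (p - 1) / (2 * p)"
  define c where "c = (\<lambda>K. exp (- 2 / K) * (1 - K powr (- b)))"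
  have b: "b > 0"
    using p by (simp add: b_def)
  have "\<exists>K\<ge>1. C < q * c K"
  proof -
    have "(c \<longlongrightarrow> exp 0 * (1 - 0)) at_top"
      unfolding c_def using b
      by (intro tendsto_intros tendsto_neg_powr filterlim_ident tendsto_divide_0[OF tendsto_const]
          filterlim_at_top_imp_at_infinity) auto
    then have "((\<lambda>K. q * c K) \<longlongrightarrow> q * 1) at_top"
      by (intro tendsto_intros) simp
    then have "eventually (\<lambda>K. C < q * c K) at_top"
      using C by (intro order_tendstoD(1)[of _ "q * 1"]) (simp_all add: q_def)
    with eventually_ge_at_top[of 1] have "eventually (\<lambda>K. 1 \<le> K \<and> C < q * c K) at_top"
      by eventually_elim simp
    then show ?thesis
      using eventually_happens' trivial_limit_at_top_linorder by blast
  qed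
  then obtain K where K: "K \<ge> 1" "C < q * c K" by blast
  \<comment> \<open>Large enough that L \<ge> N implies both L > 1 and K (1 + K) \<le> L -
    K.\<close>
  define N where "N = 2 + K + K * (1 + K)"
  have "\<exists>L\<ge>N. C powr p * ln L < (q * c K) powr p * (ln (L - K) - ln (K * (1 + K)))"
  \<comment> \<open>If no such \<open>L\<close> existed, comparing the coefficients of ln L would
    give (q * c K)^p \<le> C^p, against the choice of \<open>K\<close>.\<close>
  proof (rule ccontr)
    assume *: "\<not> ?thesis"
    have "(q * c K) powr p \<le> C powr p"
    proof (rule le_if_log_growth_le[where K = K and N = N and d = "ln (K * (1 + K))"])
      show "(q * c K) powr p * (ln (L - K) - ln (K * (1 + K))) \<le> C powr p * ln L" if "N \<le> L" for L
        using * that by force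
    qed (use K in auto)
    moreover have "C powr p < (q * c K) powr p"
      using C K p by (intro powr_less_mono2) auto
    ultimately show False by simp
  qed
  then obtain L where L: "L \<ge> N" "C powr p * ln L < (q * c K) powr p * (ln (L - K) - ln (K * (1 + K)))"
    by blast
  obtain F where F: "\<And>x. (F has_real_derivative cut_powr (1 - b) L x) (at x)"
    by (rule cut_powr_antiderivative[of "1 - b" L]) blast
  have L1: "1 < L" "K * (1 + K) \<le> L - K"
  proof -
    have "0 \<le> K * (1 + K)"
      using K by simp
    then show "1 < L" "K * (1 + K) \<le> L - K"
      using L(1) K unfolding N_def by linarith+
  qed
  have contF: "continuous_on UNIV F"
    using DERIV_isCont[OF F] by (simp add: continuous_at_imp_continuous_on)
  have [measurable]: "F \<in> borel_measurable borel" "cut_powr (1 - b) L \<in> borel_measurable borel"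
    using contF continuous_on_cut_powr by (auto intro: borel_measurable_continuous_onI)
  define UA where "UA = (\<integral>\<^sup>+ t. ennreal ((\<bar>F (t\<^sup>2) - F 0\<bar> / \<bar>t\<bar>) powr p) * indicator {0<..} t \<partial>lborel)"
  define UB where "UB = (\<integral>\<^sup>+ t. ennreal ((2 * \<bar>t\<bar> * cut_powr (1 - b) L (t\<^sup>2)) powr p) * indicator {0<..} t \<partial>lborel)"
  have UB: "UB \<le> ennreal (2 powr p * (ln L / 2))"
    unfolding UB_def b_def by (rule cut_powr_half_line_upper[OF p L1(1)])
  then have "ennreal (C powr p) * UB \<le> ennreal (C powr p) * ennreal (2 powr p * (ln L / 2))"
    by (intro mult_left_mono) simp_all
  also have "\<dots> = ennreal (2 powr p * (C powr p * ln L) / 2)"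
    using L1 by (simp add: mult_ac flip: ennreal_mult)
  also have "\<dots> < ennreal (2 powr p * ((q * c K) powr p * (ln (L - K) - ln (K * (1 + K)))) / 2)"
    using L(2) L1 by (intro ennreal_lessI) (auto intro!: divide_strict_right_mono mult_pos_pos le_less_trans[OF _ L(2)])
  also have "2 powr p * ((q * c K) powr p * (ln (L - K) - ln (K * (1 + K)))) / 2 =
      (c K * (2 * q)) powr p * ((ln (L - K) - ln (K * (1 + K))) / 2)"
    by (simp add: powr_mult mult_ac)
  also have "ennreal \<dots> \<le> UA"
    unfolding UA_def c_def b_def q_def
    by (intro cut_powr_half_line_lower p K L1 F[unfolded b_def])
  finally have less: "ennreal (C powr p) * UB < UA" .
  have less2: "ennreal (C powr p) * (UB + UB) < UA + UA"
    using add_strict_mono[OF less less] by (simp add: distrib_left)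
  have UA_eq: "(\<integral>\<^sup>+ t. ennreal ((\<bar>F (t\<^sup>2) - F 0\<bar> / \<bar>t\<bar>) powr p) \<partial>lborel) = UA + UA"
    by (subst nn_integral_split_at[of _ 0]) (simp_all add: UA_def)
  have UB_eq: "(\<integral>\<^sup>+ t. ennreal ((2 * \<bar>t\<bar> * cut_powr (1 - b) L (t\<^sup>2)) powr p) \<partial>lborel) = UB + UB"
    by (subst nn_integral_split_at[of _ 0]) (simp_all add: UB_def)
  have fin: "UB + UB < \<infinity>"
    using le_less_trans[OF UB ennreal_less_top] by simp
  show ?thesis
    by (rule that[OF L1(1) F[unfolded b_def]]) (use less2 fin in \<open>simp_all only: UA_eq UB_eq[unfolded b_def]\<close>)
qed

section \<open>Radial functions in polar form\<close>

text \<open>Along every ray the integrand is the same function \<open>G\<close>, only shifted by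
  \<open>s y\<close> and scaled by \<open>c\<close>. The affine substitution removes the dependence
  on the ray at the cost of |c|, and the shell weight splits off as a factor.\<close>

lemma nn_integral_norm_powr_eq_polar:
  fixes H :: "real ^ 'n \<Rightarrow> 'b::real_normed_vector"
  assumes [measurable]: "H \<in> borel_measurable borel" "G \<in> borel_measurable borel" and c: "c \<noteq> 0" and G: "\<And>t. 0 \<le> G t"
    and eq: "\<And>y t. y \<in> unit_shell \<Longrightarrow>
      exp t ^ CARD('n) * norm (H (exp t *\<^sub>R y)) powr p = norm y powr (- real CARD('n)) * G (s y + c * t)"
  shows "ennreal \<bar>c\<bar> * (\<integral>\<^sup>+ x. ennreal (norm (H x) powr p) \<partial>lborel) =
    (\<integral>\<^sup>+ y. indicator unit_shell y * ennreal (norm (y :: real ^ 'n) powr (- real CARD('n))) \<partial>lborel) *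
    (\<integral>\<^sup>+ t. ennreal (G t) \<partial>lborel)"
proof -
  define w where "w = (\<lambda>y :: real ^ 'n. norm y powr (- real CARD('n)))"
  have "ennreal \<bar>c\<bar> * (\<integral>\<^sup>+ x. ennreal (norm (H x) powr p) \<partial>lborel) =
    ennreal \<bar>c\<bar> * (\<integral>\<^sup>+ y. indicator unit_shell y *
       (\<integral>\<^sup>+ t. ennreal (exp t ^ DIM(real ^ 'n)) * ennreal (norm (H (exp t *\<^sub>R y)) powr p) \<partial>lborel) \<partial>lborel)"
    by (subst nn_integral_unit_shell) simp_all
  also have "\<dots> = (\<integral>\<^sup>+ y. ennreal \<bar>c\<bar> * (indicator unit_shell y *
       (\<integral>\<^sup>+ t. ennreal (exp t ^ DIM(real ^ 'n)) * ennreal (norm (H (exp t *\<^sub>R y)) powr p) \<partial>lborel)) \<partial>lborel)"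
    by (intro nn_integral_cmult[symmetric]) measurable
  also have "\<dots> = (\<integral>\<^sup>+ y. indicator unit_shell y * ennreal (w y) * (\<integral>\<^sup>+ t. ennreal (G t) \<partial>lborel) \<partial>lborel)"
  proof (rule nn_integral_cong)
    fix y :: "real ^ 'n"
    show "ennreal \<bar>c\<bar> * (indicator unit_shell y *
        (\<integral>\<^sup>+ t. ennreal (exp t ^ DIM(real ^ 'n)) * ennreal (norm (H (exp t *\<^sub>R y)) powr p) \<partial>lborel)) =
      indicator unit_shell y * ennreal (w y) * (\<integral>\<^sup>+ t. ennreal (G t) \<partial>lborel)"
    proof (cases "y \<in> unit_shell")
      case True
      have "(\<integral>\<^sup>+ t. ennreal (exp t ^ DIM(real ^ 'n)) * ennreal (norm (H (exp t *\<^sub>R y)) powr p) \<partial>lborel) =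
          (\<integral>\<^sup>+ t. ennreal (w y) * ennreal (G (s y + c * t)) \<partial>lborel)"
        using eq[OF True] by (simp add: w_def G flip: ennreal_mult)
      also have "\<dots> = ennreal (w y) * (\<integral>\<^sup>+ t. ennreal (G (s y + c * t)) \<partial>lborel)"
        by (intro nn_integral_cmult) measurable
      finally show ?thesis
        using True nn_integral_real_affine[of "\<lambda>t. ennreal (G t)" c "s y"] c by (simp add: mult_ac)
    qed simp
  qed
  also have "\<dots> = (\<integral>\<^sup>+ y. indicator unit_shell y * ennreal (w y) \<partial>lborel) * (\<integral>\<^sup>+ t. ennreal (G t) \<partial>lborel)"
    unfolding w_def by (intro nn_integral_multc) measurable
  finally show ?thesis by (simp add: w_def)
qed

text \<open>This integral is the surface area of the unit sphere, because the radial integral of 1/r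
  from 1 to e is 1. It is finite since the weight is at most 1 on a bounded set.\<close>

lemma unit_shell_weight_pos_finite:
  "0 < (\<integral>\<^sup>+ y. indicator unit_shell y * ennreal (norm (y :: real ^ 'n) powr (- real CARD('n))) \<partial>lborel)"
  "(\<integral>\<^sup>+ y. indicator unit_shell y * ennreal (norm (y :: real ^ 'n) powr (- real CARD('n))) \<partial>lborel) < \<infinity>"
proof -
  let ?I = "\<integral>\<^sup>+ y. indicator unit_shell y * ennreal (norm (y :: real ^ 'n) powr (- real CARD('n))) \<partial>lborel"
  have "?I \<le> (\<integral>\<^sup>+ y. indicator (cball (0 :: real ^ 'n) (exp 1)) y \<partial>lborel)"
  proof (rule nn_integral_mono)
    fix y :: "real ^ 'n"
    show "indicator unit_shell y * ennreal (norm y powr (- real CARD('n))) \<le> indicator (cball 0 (exp 1)) y"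
    proof (cases "y \<in> unit_shell")
      case True
      then have "norm y powr (- real CARD('n)) \<le> norm y powr 0"
        by (intro powr_mono) (auto simp: unit_shell_def)
      then show ?thesis
        using True by (auto simp: unit_shell_def split: if_splits)
    qed simp
  qed
  also have "\<dots> < \<infinity>"
    using emeasure_bounded_finite[OF bounded_cball, of "0 :: real ^ 'n" "exp 1"] by simp
  finally show "?I < \<infinity>" .
  show "0 < ?I"
  proof (rule ccontr)
    assume "\<not> 0 < ?I"
    then have "AE y in (lborel :: (real ^ 'n) measure). indicator unit_shell y * ennreal (norm y powr (- real CARD('n))) = 0"
      by (subst nn_integral_0_iff_AE[symmetric]) simp_all
    then have "AE y in (lborel :: (real ^ 'n) measure). y \<notin> unit_shell"
      by eventually_elim (auto simp: unit_shell_def indicator_def split: if_splits)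
    \<comment> \<open>If the shell were a null set, the shell formula applied to the constant 1
      would give the whole space measure 0.\<close>
    then have "(\<integral>\<^sup>+ y. indicator unit_shell (y :: real ^ 'n) *
        (\<integral>\<^sup>+ t. ennreal (exp t ^ DIM(real ^ 'n)) * 1 \<partial>lborel) \<partial>lborel) = (\<integral>\<^sup>+ y. 0 \<partial>(lborel :: (real ^ 'n) measure))"
      by (rule nn_integral_cong_AE[OF eventually_mono]) simp
    then have "(\<integral>\<^sup>+ y. 1 \<partial>(lborel :: (real ^ 'n) measure)) = 0"
      by (subst nn_integral_unit_shell) simp_all
    then show False
      by (simp add: emeasure_lborel_UNIV)
  qed
qed

text \<open>The single radius R = 1 bounds the supremum from below. The claim is made for the full
  gradient norm, the larger of the two, so that it also covers the radial norm.\<close>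

lemma hardy_sharp:
  assumes p: "1 < p" and C: "C < ennreal (p / (p - 1))"
  shows "\<exists>f :: real ^ 'n \<Rightarrow> complex. test_fun_punctured f \<and> \<not> hardy_lhs p f \<le> C * gradient_norm p f"
proof -
  obtain r where r: "C = ennreal r" "0 \<le> r"
    using C by (cases C) auto
  then have rq: "r < p / (p - 1)"
    using C by (simp add: ennreal_less_iff)
  define a where "a = 1 - (p - 1) / (2 * p)"
  obtain L F where L: "1 < L" and F: "\<And>x. (F has_real_derivative cut_powr a L x) (at x)"
    and sharp: "(\<integral>\<^sup>+ t. ennreal ((\<bar>F (t\<^sup>2) - F 0\<bar> / \<bar>t\<bar>) powr p) \<partial>lborel) >
     ennreal (r powr p) * (\<integral>\<^sup>+ t. ennreal ((2 * \<bar>t\<bar> * cut_powr a L (t\<^sup>2)) powr p) \<partial>lborel)"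
    and fin: "(\<integral>\<^sup>+ t. ennreal ((2 * \<bar>t\<bar> * cut_powr a L (t\<^sup>2)) powr p) \<partial>lborel) < \<infinity>"
    unfolding a_def by (rule hardy_line_sharp[OF p r(2) rq]) blast
  \<comment> \<open>\<open>F\<close> is constant beyond \<open>L\<close>; subtracting from that
    constant gives a compactly supported profile, and the constant cancels in f - f_R.\<close>
  define \<Phi> where "\<Phi> = (\<lambda>y. F L - F y)"
  define f where "f = (\<lambda>x :: real ^ 'n. complex_of_real (log_profile \<Phi> (x \<bullet> x)))"
  have d\<Phi>: "(\<Phi> has_real_derivative - cut_powr a L y) (at y)" for y
    unfolding \<Phi>_def using F[of y] by (auto intro!: derivative_eq_intros)
  have Ck: "Ck_real k UNIV \<Phi>" for k
  proof -
    have "Ck_real k UNIV (\<lambda>y. (- 1) * cut_powr a L y)"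
      by (intro Ck_real_mult Ck_real_const Ck_real_cut_powr) simp_all
    then show ?thesis
      using d\<Phi> by (intro Ck_real_SucD[OF Ck_real_SucI[of UNIV \<Phi> "\<lambda>y. (- 1) * cut_powr a L y"]]) simp_all
  qed
  have zero: "\<Phi> y = 0" if "L \<le> y" for y
  proof -
    have "F L \<le> F y"
      by (rule DERIV_nonneg_imp_nondecreasing[OF that]) (use F cut_powr_nonneg in blast)
    moreover have "F y \<le> F L"
      by (rule DERIV_nonpos_imp_nonincreasing[OF that]) (use F cut_powr_eq_0 in force)
    ultimately show ?thesis by (simp add: \<Phi>_def)
  qed
  have tf: "test_fun_punctured f"
    unfolding f_def using L by (intro test_fun_punctured_log_profile[OF Ck zero]) auto
  have [measurable]: "F \<in> borel_measurable borel" "cut_powr a L \<in> borel_measurable borel"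
    using DERIV_isCont[OF F]
    by (auto intro!: borel_measurable_continuous_onI continuous_on_cut_powr
        intro: continuous_at_imp_continuous_on)
  have contf: "continuous_on UNIV f"
    using test_fun_punctured_differentiable(1)[OF tf]
    by (intro continuous_at_imp_continuous_on ballI differentiable_imp_continuous_within)
  have [measurable]: "f \<in> borel_measurable borel"
    using contf by (auto intro!: borel_measurable_continuous_onI)
  have [measurable]: "grad f \<in> borel_measurable borel"
    unfolding grad_def
    by (intro borel_measurable_continuous_onI continuous_on_vec_lambda test_fun_punctured_differentiable(2)[OF tf])
  have log_inner: "exp t *\<^sub>R y \<bullet> exp t *\<^sub>R y > 0"
      "ln (exp t *\<^sub>R y \<bullet> exp t *\<^sub>R y) = 2 * ln (norm y) + 2 * t" if "y \<noteq> 0" for t and y :: "real ^ 'n"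
  proof -
    have "exp t *\<^sub>R y \<bullet> exp t *\<^sub>R y = (exp t * norm y)\<^sup>2"
      by (simp add: power2_norm_eq_inner power_mult_distrib) (simp add: power2_eq_square)
    moreover have "exp t * norm y > 0"
      using that by simp
    ultimately show "exp t *\<^sub>R y \<bullet> exp t *\<^sub>R y > 0"
      "ln (exp t *\<^sub>R y \<bullet> exp t *\<^sub>R y) = 2 * ln (norm y) + 2 * t"
      using that by (auto simp: ln_realpow ln_mult)
  qed
  have f_eq: "f (exp t *\<^sub>R y) = complex_of_real (\<Phi> ((2 * ln (norm y) + 2 * t)\<^sup>2))" if "y \<noteq> 0" for t y
    using log_inner[OF that] by (simp only: f_def log_profile_def if_True)
  \<comment> \<open>The 4 collects a 2 from the gradient of \<open>x \<bullet> x\<close> and a 2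
    from differentiating the squared logarithm.\<close>
  have grad_eq: "norm (grad f x) * norm x = 4 * \<bar>ln (x \<bullet> x)\<bar> * cut_powr a L ((ln (x \<bullet> x))\<^sup>2)"
    if x: "x \<noteq> 0" for x
  proof -
    let ?s = "x \<bullet> x"
    let ?d = "- cut_powr a L ((ln ?s)\<^sup>2) * (2 * ln ?s / ?s)"
    have s: "?s > 0" using x by simp
    have "((\<lambda>s. (ln s)\<^sup>2) has_real_derivative 2 * ln ?s / ?s) (at ?s)"
      using s by (auto intro!: derivative_eq_intros)
    from DERIV_chain2[OF d\<Phi> this]
    have "(log_profile \<Phi> has_real_derivative ?d) (at ?s)"
      by (rule has_field_derivative_transform_within_open[of _ _ _ "{0<..}"])
         (use s in \<open>auto simp: log_profile_def\<close>)
    from norm_grad_radial[OF this]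
    have "norm (grad f x) = 2 * \<bar>?d\<bar> * norm x"
      by (simp only: f_def)
    moreover have "norm x * norm x = ?s"
      by (simp add: power2_norm_eq_inner flip: power2_eq_square)
    ultimately have "norm (grad f x) * norm x = 2 * \<bar>?d\<bar> * ?s"
      by (simp only: mult.assoc)
    also have "\<dots> = 4 * \<bar>ln ?s\<bar> * cut_powr a L ((ln ?s)\<^sup>2)"
      using s cut_powr_nonneg[of a L "(ln ?s)\<^sup>2"] by (simp add: abs_mult)
    finally show ?thesis .
  qed
  define D where "D = (\<lambda>x. (1 / norm x powr (real CARD('n) / p - 1)) *\<^sub>R grad f x)"
  have [measurable]: "D \<in> borel_measurable borel"
    unfolding D_def by measurable
  have [measurable]: "log_quotient p 1 f \<in> borel_measurable borel"
    unfolding log_quotient_def spherical_restr_def by measurable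
  define IA IB A B \<sigma> where
    "IA = (\<integral>\<^sup>+ x. ennreal (norm (log_quotient p 1 f x) powr p) \<partial>lborel)"
    and "IB = (\<integral>\<^sup>+ x. ennreal (norm (D x) powr p) \<partial>lborel)"
    and "A = (\<integral>\<^sup>+ t. ennreal ((\<bar>F (t\<^sup>2) - F 0\<bar> / \<bar>t\<bar>) powr p) \<partial>lborel)"
    and "B = (\<integral>\<^sup>+ t. ennreal ((2 * \<bar>t\<bar> * cut_powr a L (t\<^sup>2)) powr p) \<partial>lborel)"
    and "\<sigma> = (\<integral>\<^sup>+ y. indicator unit_shell y * ennreal (norm (y :: real ^ 'n) powr (- real CARD('n))) \<partial>lborel)"
  have "ennreal \<bar>2\<bar> * IA = \<sigma> * (\<integral>\<^sup>+ t. ennreal (2 powr p * (\<bar>F (t\<^sup>2) - F 0\<bar> / \<bar>t\<bar>) powr p) \<partial>lborel)"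
    unfolding IA_def \<sigma>_def
  proof (rule nn_integral_norm_powr_eq_polar[where s = "\<lambda>y. 2 * ln (norm y)"])
    fix y :: "real ^ 'n" and t :: real
    assume "y \<in> unit_shell"
    then have y: "y \<noteq> 0" by (auto simp: unit_shell_def)
    \<comment> \<open>This is ln (x \<bullet> x) at x = exp t * y, twice the distance in t from the
      unit sphere, with sign. The resulting factor 2^p occurs in both integrals and cancels in the
      end.\<close>
    define \<tau> where "\<tau> = 2 * ln (norm y) + 2 * t"
    have "norm (f (exp t *\<^sub>R y) - f (exp (ln (1 / norm y)) *\<^sub>R y)) = \<bar>F (\<tau>\<^sup>2) - F 0\<bar>"
      unfolding f_eq[OF y] using y
      by (simp add: \<Phi>_def \<tau>_def ln_div abs_minus_commute flip: of_real_diff)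
    moreover have "\<bar>t - ln (1 / norm y)\<bar> = \<bar>\<tau>\<bar> / 2"
      using y by (simp add: \<tau>_def ln_div abs_if)
    moreover have "(\<bar>F (\<tau>\<^sup>2) - F 0\<bar> / (\<bar>\<tau>\<bar> / 2)) powr p = 2 powr p * (\<bar>F (\<tau>\<^sup>2) - F 0\<bar> / \<bar>\<tau>\<bar>) powr p"
      by (subst powr_mult[symmetric]) (simp add: mult.commute)
    ultimately show "exp t ^ CARD('n) * norm (log_quotient p 1 f (exp t *\<^sub>R y)) powr p = norm y powr - real CARD('n) *
      (2 powr p * (\<bar>F ((2 * ln (norm y) + 2 * t)\<^sup>2) - F 0\<bar> / \<bar>2 * ln (norm y) + 2 * t\<bar>) powr p)"
      unfolding \<tau>_def[symmetric] using exp_pow_log_quotient[OF p zero_less_one y, of t f] by (simp only:)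
  qed (auto intro!: measurable)
  also have "\<dots> = \<sigma> * ennreal (2 powr p) * A"
    unfolding A_def by (simp add: ennreal_mult nn_integral_cmult mult.assoc)
  finally have A: "2 * IA = \<sigma> * ennreal (2 powr p) * A"
    by simp
  have "ennreal \<bar>2\<bar> * IB = \<sigma> * (\<integral>\<^sup>+ t. ennreal (2 powr p * (2 * \<bar>t\<bar> * cut_powr a L (t\<^sup>2)) powr p) \<partial>lborel)"
    unfolding IB_def \<sigma>_def
  proof (rule nn_integral_norm_powr_eq_polar[where s = "\<lambda>y. 2 * ln (norm y)"])
    fix y :: "real ^ 'n" and t :: real
    assume "y \<in> unit_shell"
    then have y: "y \<noteq> 0" by (auto simp: unit_shell_def)
    define \<tau> where "\<tau> = 2 * ln (norm y) + 2 * t"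
    have "norm ((exp t * norm y) *\<^sub>R grad f (exp t *\<^sub>R y)) = norm (grad f (exp t *\<^sub>R y)) * norm (exp t *\<^sub>R y)"
      by simp
    also have "\<dots> = 2 * (2 * \<bar>\<tau>\<bar> * cut_powr a L (\<tau>\<^sup>2))"
      using y by (subst grad_eq) (simp_all only: log_inner(2)[OF y] \<tau>_def, simp_all)
    finally have "norm ((exp t * norm y) *\<^sub>R grad f (exp t *\<^sub>R y)) powr p =
        2 powr p * (2 * \<bar>\<tau>\<bar> * cut_powr a L (\<tau>\<^sup>2)) powr p"
      by (simp only: powr_mult)
    then show "exp t ^ CARD('n) * norm (D (exp t *\<^sub>R y)) powr p = norm y powr - real CARD('n) *
      (2 powr p * (2 * \<bar>2 * ln (norm y) + 2 * t\<bar> * cut_powr a L ((2 * ln (norm y) + 2 * t)\<^sup>2)) powr p)"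
      using exp_pow_radial_deriv[OF p y, of t "grad f"] by (simp only: \<tau>_def D_def)
  qed (auto intro!: measurable)
  also have "\<dots> = \<sigma> * ennreal (2 powr p) * B"
    unfolding B_def by (simp add: ennreal_mult nn_integral_cmult mult.assoc)
  finally have B: "2 * IB = \<sigma> * ennreal (2 powr p) * B"
    by simp
  have \<sigma>: "0 < \<sigma>" "\<sigma> < \<infinity>"
    unfolding \<sigma>_def by (rule unit_shell_weight_pos_finite)+
  \<comment> \<open>The factor common to both integrals; being positive and finite, it can be
    cancelled in \<open>ennreal\<close>.\<close>
  define \<kappa> where "\<kappa> = \<sigma> * ennreal (2 powr p)"
  have \<kappa>: "\<kappa> \<noteq> 0" "\<kappa> < \<infinity>"
    using \<sigma> by (auto simp: \<kappa>_def ennreal_mult_less_top)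
  have "2 * IB < \<infinity>"
    using fin \<kappa> unfolding B \<kappa>_def[symmetric] B_def[symmetric] by (simp add: ennreal_mult_less_top)
  then have IB: "IB \<noteq> \<infinity>"
    by (auto simp: ennreal_mult_eq_top_iff)
  have "\<not> hardy_lhs p f \<le> C * gradient_norm p f"
  proof
    assume *: "hardy_lhs p f \<le> C * gradient_norm p f"
    have "Lp_norm p (log_quotient p 1 f) \<le> hardy_lhs p f"
      unfolding hardy_lhs_def by (rule SUP_upper) simp
    also note *
    also have "C * gradient_norm p f = ennreal r * Lp_norm p D"
      by (simp add: r gradient_norm_def D_def)
    finally have "IA \<le> ennreal (r powr p) * IB"
      unfolding IA_def IB_def using p r(2) IB
      by (intro Lp_norm_le_mult_imp_nn_integral_le) (auto simp: IB_def)
    then have "2 * IA \<le> ennreal (r powr p) * (2 * IB)"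
      using mult_left_mono[of IA "ennreal (r powr p) * IB" 2] by (simp add: mult.left_commute)
    then have "\<kappa> * A \<le> \<kappa> * (ennreal (r powr p) * B)"
      unfolding A B \<kappa>_def[symmetric] by (simp add: mult_ac)
    then have "A \<le> ennreal (r powr p) * B"
      using \<kappa> by (subst (asm) ennreal_mult_le_mult_iff) auto
    then show False
      using sharp by (simp add: A_def B_def)
  qed
  with tf show ?thesis by blast
qed

theorem mainTheorem2:
  fixes p :: real
  assumes "CARD('n::finite) \<ge> 2" and "1 < p"
  shows "(\<forall>f :: real ^ 'n \<Rightarrow> complex. test_fun_punctured f \<longrightarrow>
            hardy_lhs p f \<le> ennreal (p / (p - 1)) * radial_norm p f \<and>
            ennreal (p / (p - 1)) * radial_norm p f
              \<le> ennreal (p / (p - 1)) * gradient_norm p f) \<and>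
         (\<forall>C :: ennreal. C < ennreal (p / (p - 1)) \<longrightarrow>
            \<not> (\<forall>f :: real ^ 'n \<Rightarrow> complex. test_fun_punctured f \<longrightarrow>
                 hardy_lhs p f \<le> C * radial_norm p f)) \<and>
         (\<forall>C :: ennreal. C < ennreal (p / (p - 1)) \<longrightarrow>
            \<not> (\<forall>f :: real ^ 'n \<Rightarrow> complex. test_fun_punctured f \<longrightarrow>
                 hardy_lhs p f \<le> C * gradient_norm p f))"
proof (intro conjI allI impI)
  fix f :: "real ^ 'n \<Rightarrow> complex"
  assume "test_fun_punctured f"
  then show "hardy_lhs p f \<le> ennreal (p / (p - 1)) * radial_norm p f"
    by (rule hardy_lhs_le_radial_norm[OF assms(2)])
  show "ennreal (p / (p - 1)) * radial_norm p f \<le> ennreal (p / (p - 1)) * gradient_norm p f"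
    by (intro mult_left_mono radial_norm_le_gradient_norm assms) simp
next
  fix C :: ennreal
  assume "C < ennreal (p / (p - 1))"
  then obtain f :: "real ^ 'n \<Rightarrow> complex" where f: "test_fun_punctured f" "\<not> hardy_lhs p f \<le> C * gradient_norm p f"
    using hardy_sharp[OF assms(2)] by blast
  then show "\<not> (\<forall>f :: real ^ 'n \<Rightarrow> complex. test_fun_punctured f \<longrightarrow> hardy_lhs p f \<le> C * gradient_norm p f)"
    by blast
  \<comment> \<open>The radial norm is the smaller one, so the same \<open>f\<close> refutes
    \<open>C\<close> there as well.\<close>
  have "C * radial_norm p f \<le> C * gradient_norm p f"
    by (intro mult_left_mono radial_norm_le_gradient_norm assms) simp
  with f show "\<not> (\<forall>f :: real ^ 'n \<Rightarrow> complex. test_fun_punctured f \<longrightarrow> hardy_lhs p f \<le> C * radial_norm p f)"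
    using order_trans by blast
qed

end
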